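(* Let \(\mathcal V\) be a universe. (i) There is a locally small \(\delta_{\mathcal V}\)-complete poset with decidable equality that is nontrivial in an unspecified way if and only if weak excluded middle in \(\mathcal V\) holds. (ii) There is a locally small \(\delta_{\mathcal V}\)-complete poset with decidable equality that is positive in an unspecified way if and only if excluded middle in \(\mathcal V\) holds.
   Context: Work in univalent foundations (intensional Martin-Löf type theory with universes, function and propositional extensionality, propositional truncations; \(\exists_{x:X}Y(x):=\|\Sigma_{x:X}Y(x)\|\)). A poset is a type \(X\) with a proposition-valued reflexive, transitive, antisymmetric relation \(\sqsubseteq\); it is \(\delta_{\mathcal V}\)-complete if for all \(x\sqsubseteq y\) and propositions \(P:\mathcal V\), the family \(\delta_{x,y,P}:\mathbf 1+P\to X\), \(\mathrm{inl}(\star)\mapsto x\), \(\mathrm{inr}(p)\mapsto y\), has a supremum \(\bigvee\delta_{x,y,P}\). Here \(x\) is strictly below \(y\) if \(x\sqsubseteq y\) and for every \(z\sqsupseteq y\) and proposition \(P:\mathcal V\), \(z=\bigvee\delta_{x,z,P}\) implies \(P\). Nontrivial in an unspecified way: \(\exists_{x}\exists_{y}((x\sqsubseteq y)\times(x\neq y))\); positive in an unspecified way: \(\exists_x\exists_y(x\text{ strictly below }y)\). Locally small: there is a \(\mathcal V\)-valued relation \(\sqsubseteq_{\mathcal V}\) with \((x\sqsubseteq y)\simeq(x\sqsubseteq_{\mathcal V}y)\). Decidable equality: \((x=y)+\lnot(x=y)\) for all \(x,y\). Excluded middle in \(\mathcal V\): \(P\) or \(\lnot P\) for every proposition \(P:\mathcal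 V\); weak excluded middle in \(\mathcal V\): \(\lnot P\) or \(\lnot\lnot P\) for every proposition \(P:\mathcal V\). *)

theory Defs
  imports Main
begin

text \<open>
  HOL is classical, so (weak) excluded middle stated for HOL propositions is simply true and the
  equivalences of interest would be void. The statement is a claim of provability in a
  constructive type theory; we therefore formalise that type theory (syntax and derivations) and
  state that the types expressing the two equivalences are inhabited by closed terms.

  The theory is intensional Martin-Loef type theory in the style of the appendix of the HoTT book:
  dependent products and sums, binary sums, empty and unit types in every universe, natural
  numbers, identity types, and a hierarchy of non-cumulative Russell universes; on top of this
  function extensionality, propositional extensionality and propositional truncations.
  Univalence and type formers not needed here (such as W-types) are omitted, so derivability in
  this theory is at least as strong as derivability in richer ones.
\<close>

section \<open>Raw terms\<close>

text \<open>
  De Bruijn indices. Binding structure: the second argument of \<open>Pi\<close>, \<open>Sig\<close> and \<open>Lam\<close> binds one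
  variable. In the eliminators the first argument is the motive, binding one variable (two for
  \<open>J\<close>: the endpoint and then the path); the branches bind two variables in \<open>SigInd\<close>, one in
  each branch of \<open>PlusInd\<close>, and in the successor branch of \<open>NatInd\<close> two: the predecessor and then
  the induction hypothesis. All other arguments bind nothing. If two variables are bound, the
  later one has index 0.
\<close>

datatype tm =
    Var nat
  | Univ nat
  | Pi tm tm | Lam tm tm | App tm tm
  | Sig tm tm | Pr tm tm | Fst tm | Snd tm | SigInd tm tm tm
  | Plus tm tm | InL tm | InR tm | PlusInd tm tm tm tm
  | Empty nat | EmptyInd tm tm
  | Unit nat | Star nat | UnitInd tm tm tm
  | NatT | Zero | Succ tm | NatInd tm tm tm tm
  | Eq tm tm tm | Rfl tm | J tm tm tm tm
  | Trunc tm | TrIn tm | TrEq tm tm | TrRec tm tm tm tm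
  | FunExt tm tm tm
  | PropExt tm tm tm tm tm tm

fun scons :: "'a \<Rightarrow> (nat \<Rightarrow> 'a) \<Rightarrow> nat \<Rightarrow> 'a" where
  "scons a s 0 = a"
| "scons a s (Suc n) = s n"

definition up_ren :: "(nat \<Rightarrow> nat) \<Rightarrow> nat \<Rightarrow> nat" where
  "up_ren r = scons 0 (\<lambda>n. Suc (r n))"

primrec ren :: "(nat \<Rightarrow> nat) \<Rightarrow> tm \<Rightarrow> tm" where
  "ren r (Var n) = Var (r n)"
| "ren r (Univ i) = Univ i"
| "ren r (Pi A B) = Pi (ren r A) (ren (up_ren r) B)"
| "ren r (Lam A b) = Lam (ren r A) (ren (up_ren r) b)"
| "ren r (App f a) = App (ren r f) (ren r a)"
| "ren r (Sig A B) = Sig (ren r A) (ren (up_ren r) B)"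
| "ren r (Pr a b) = Pr (ren r a) (ren r b)"
| "ren r (Fst p) = Fst (ren r p)"
| "ren r (Snd p) = Snd (ren r p)"
| "ren r (SigInd C g p) = SigInd (ren (up_ren r) C) (ren (up_ren (up_ren r)) g) (ren r p)"
| "ren r (Plus A B) = Plus (ren r A) (ren r B)"
| "ren r (InL a) = InL (ren r a)"
| "ren r (InR b) = InR (ren r b)"
| "ren r (PlusInd C c d s) =
     PlusInd (ren (up_ren r) C) (ren (up_ren r) c) (ren (up_ren r) d) (ren r s)"
| "ren r (Empty i) = Empty i"
| "ren r (EmptyInd C e) = EmptyInd (ren (up_ren r) C) (ren r e)"
| "ren r (Unit i) = Unit i"
| "ren r (Star i) = Star i"
| "ren r (UnitInd C c s) = UnitInd (ren (up_ren r) C) (ren r c) (ren r s)"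
| "ren r NatT = NatT"
| "ren r Zero = Zero"
| "ren r (Succ n) = Succ (ren r n)"
| "ren r (NatInd C z s n) =
     NatInd (ren (up_ren r) C) (ren r z) (ren (up_ren (up_ren r)) s) (ren r n)"
| "ren r (Eq A a b) = Eq (ren r A) (ren r a) (ren r b)"
| "ren r (Rfl a) = Rfl (ren r a)"
| "ren r (J C d b p) = J (ren (up_ren (up_ren r)) C) (ren r d) (ren r b) (ren r p)"
| "ren r (Trunc A) = Trunc (ren r A)"
| "ren r (TrIn a) = TrIn (ren r a)"
| "ren r (TrEq a b) = TrEq (ren r a) (ren r b)"
| "ren r (TrRec P h f a) = TrRec (ren r P) (ren r h) (ren r f) (ren r a)"
| "ren r (FunExt f g h) = FunExt (ren r f) (ren r g) (ren r h)"
| "ren r (PropExt P Q h k f g) =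
     PropExt (ren r P) (ren r Q) (ren r h) (ren r k) (ren r f) (ren r g)"

definition lift :: "tm \<Rightarrow> nat \<Rightarrow> tm"  (infixl "\<up>" 95) where
  "t \<up> n = ren (\<lambda>i. i + n) t"

definition up_sub :: "(nat \<Rightarrow> tm) \<Rightarrow> nat \<Rightarrow> tm" where
  "up_sub s = scons (Var 0) (\<lambda>n. s n \<up> 1)"

primrec sub :: "(nat \<Rightarrow> tm) \<Rightarrow> tm \<Rightarrow> tm" where
  "sub r (Var n) = r n"
| "sub r (Univ i) = Univ i"
| "sub r (Pi A B) = Pi (sub r A) (sub (up_sub r) B)"
| "sub r (Lam A b) = Lam (sub r A) (sub (up_sub r) b)"
| "sub r (App f a) = App (sub r f) (sub r a)"
| "sub r (Sig A B) = Sig (sub r A) (sub (up_sub r) B)"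
| "sub r (Pr a b) = Pr (sub r a) (sub r b)"
| "sub r (Fst p) = Fst (sub r p)"
| "sub r (Snd p) = Snd (sub r p)"
| "sub r (SigInd C g p) = SigInd (sub (up_sub r) C) (sub (up_sub (up_sub r)) g) (sub r p)"
| "sub r (Plus A B) = Plus (sub r A) (sub r B)"
| "sub r (InL a) = InL (sub r a)"
| "sub r (InR b) = InR (sub r b)"
| "sub r (PlusInd C c d s) =
     PlusInd (sub (up_sub r) C) (sub (up_sub r) c) (sub (up_sub r) d) (sub r s)"
| "sub r (Empty i) = Empty i"
| "sub r (EmptyInd C e) = EmptyInd (sub (up_sub r) C) (sub r e)"
| "sub r (Unit i) = Unit i"
| "sub r (Star i) = Star i"
| "sub r (UnitInd C c s) = UnitInd (sub (up_sub r) C) (sub r c) (sub r s)"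
| "sub r NatT = NatT"
| "sub r Zero = Zero"
| "sub r (Succ n) = Succ (sub r n)"
| "sub r (NatInd C z s n) =
     NatInd (sub (up_sub r) C) (sub r z) (sub (up_sub (up_sub r)) s) (sub r n)"
| "sub r (Eq A a b) = Eq (sub r A) (sub r a) (sub r b)"
| "sub r (Rfl a) = Rfl (sub r a)"
| "sub r (J C d b p) = J (sub (up_sub (up_sub r)) C) (sub r d) (sub r b) (sub r p)"
| "sub r (Trunc A) = Trunc (sub r A)"
| "sub r (TrIn a) = TrIn (sub r a)"
| "sub r (TrEq a b) = TrEq (sub r a) (sub r b)"
| "sub r (TrRec P h f a) = TrRec (sub r P) (sub r h) (sub r f) (sub r a)"
| "sub r (FunExt f g h) = FunExt (sub r f) (sub r g) (sub r h)"
| "sub r (PropExt P Q h k f g) =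
     PropExt (sub r P) (sub r Q) (sub r h) (sub r k) (sub r f) (sub r g)"

text \<open>
  \<open>inst b a\<close> instantiates the last variable of \<open>b\<close> by \<open>a\<close>; \<open>inst2 b a c\<close> instantiates the
  last two variables, the later one (index 0) by \<open>c\<close>. \<open>pull n C a\<close> is the motive \<open>C\<close> at a
  term \<open>a\<close> that lives in the context extended by \<open>n\<close> new variables.
\<close>

definition inst :: "tm \<Rightarrow> tm \<Rightarrow> tm" where
  "inst b a = sub (scons a Var) b"

definition inst2 :: "tm \<Rightarrow> tm \<Rightarrow> tm \<Rightarrow> tm" where
  "inst2 b a c = sub (scons c (scons a Var)) b"

definition pull :: "nat \<Rightarrow> tm \<Rightarrow> tm \<Rightarrow> tm" where
  "pull n C a = sub (scons a (\<lambda>i. Var (i + n))) C"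

definition arrow :: "tm \<Rightarrow> tm \<Rightarrow> tm" where
  "arrow A B = Pi A (B \<up> 1)"

definition is_prop :: "tm \<Rightarrow> tm" where
  "is_prop A = Pi A (Pi (A \<up> 1) (Eq (A \<up> 2) (Var 1) (Var 0)))"


section \<open>Derivations\<close>

text \<open>
  Contexts are lists of types, most recent variable first. Types are terms of some universe.
  Weakening and substitution are primitive rules; the substitution rule for judgmental equality
  subsumes the congruence rules for all argument positions that bind no variable.
  \<open>FunExt\<close> is stated as the implication from pointwise equality to equality, which
  is well known to yield that the canonical map is an equivalence. Truncation has
  the universal property only, with no judgmental computation rule. The projections \<open>Fst\<close>, \<open>Snd\<close> are
  definable from \<open>SigInd\<close>.
\<close>

inductive
      wf_ctx :: "tm list \<Rightarrow> bool"
  and typing :: "tm list \<Rightarrow> tm \<Rightarrow> tm \<Rightarrow> bool"  ("_ \<turnstile> _ \<^bold>: _" [51, 51, 51] 50)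
  and jeq :: "tm list \<Rightarrow> tm \<Rightarrow> tm \<Rightarrow> tm \<Rightarrow> bool"  ("_ \<turnstile> _ \<doteq> _ \<^bold>: _" [51, 51, 51, 51] 50)
where
  wf_nil: "wf_ctx []"
| wf_cons: "G \<turnstile> A \<^bold>: Univ i \<Longrightarrow> wf_ctx (A # G)"

\<comment> \<open>structural rules\<close>
| t_var: "G \<turnstile> A \<^bold>: Univ i \<Longrightarrow> A # G \<turnstile> Var 0 \<^bold>: A \<up> 1"
| t_weak: "\<lbrakk>G \<turnstile> b \<^bold>: B; G \<turnstile> A \<^bold>: Univ i\<rbrakk> \<Longrightarrow> A # G \<turnstile> b \<up> 1 \<^bold>: B \<up> 1"
| t_subst: "\<lbrakk>A # G \<turnstile> b \<^bold>: B; G \<turnstile> a \<^bold>: A\<rbrakk> \<Longrightarrow> G \<turnstile> inst b a \<^bold>: inst B a"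
| t_conv: "\<lbrakk>G \<turnstile> a \<^bold>: A; G \<turnstile> A \<doteq> B \<^bold>: Univ i\<rbrakk> \<Longrightarrow> G \<turnstile> a \<^bold>: B"
| e_weak: "\<lbrakk>G \<turnstile> b \<doteq> b' \<^bold>: B; G \<turnstile> A \<^bold>: Univ i\<rbrakk> \<Longrightarrow> A # G \<turnstile> b \<up> 1 \<doteq> b' \<up> 1 \<^bold>: B \<up> 1"
| e_subst: "\<lbrakk>A # G \<turnstile> b \<doteq> b' \<^bold>: B; G \<turnstile> a \<doteq> a' \<^bold>: A\<rbrakk> \<Longrightarrow> G \<turnstile> inst b a \<doteq> inst b' a' \<^bold>: inst B a"
| e_conv: "\<lbrakk>G \<turnstile> a \<doteq> b \<^bold>: A; G \<turnstile> A \<doteq> B \<^bold>: Univ i\<rbrakk> \<Longrightarrow> G \<turnstile> a \<doteq> b \<^bold>: B"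
| e_refl: "G \<turnstile> a \<^bold>: A \<Longrightarrow> G \<turnstile> a \<doteq> a \<^bold>: A"
| e_sym: "G \<turnstile> a \<doteq> b \<^bold>: A \<Longrightarrow> G \<turnstile> b \<doteq> a \<^bold>: A"
| e_trans: "\<lbrakk>G \<turnstile> a \<doteq> b \<^bold>: A; G \<turnstile> b \<doteq> c \<^bold>: A\<rbrakk> \<Longrightarrow> G \<turnstile> a \<doteq> c \<^bold>: A"

\<comment> \<open>universes\<close>
| t_univ: "wf_ctx G \<Longrightarrow> G \<turnstile> Univ i \<^bold>: Univ (Suc i)"

\<comment> \<open>dependent products\<close>
| t_pi: "\<lbrakk>G \<turnstile> A \<^bold>: Univ i; A # G \<turnstile> B \<^bold>: Univ j\<rbrakk> \<Longrightarrow> G \<turnstile> Pi A B \<^bold>: Univ (max i j)"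
| t_lam: "A # G \<turnstile> b \<^bold>: B \<Longrightarrow> G \<turnstile> Lam A b \<^bold>: Pi A B"
| t_app: "\<lbrakk>G \<turnstile> f \<^bold>: Pi A B; G \<turnstile> a \<^bold>: A\<rbrakk> \<Longrightarrow> G \<turnstile> App f a \<^bold>: inst B a"
| e_pi: "\<lbrakk>G \<turnstile> A \<doteq> A' \<^bold>: Univ i; A # G \<turnstile> B \<doteq> B' \<^bold>: Univ j\<rbrakk>
    \<Longrightarrow> G \<turnstile> Pi A B \<doteq> Pi A' B' \<^bold>: Univ (max i j)"
| e_lam: "\<lbrakk>G \<turnstile> A \<doteq> A' \<^bold>: Univ i; A # G \<turnstile> b \<doteq> b' \<^bold>: B\<rbrakk> \<Longrightarrow> G \<turnstile> Lam A b \<doteq> Lam A' b' \<^bold>: Pi A B"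
| beta: "\<lbrakk>A # G \<turnstile> b \<^bold>: B; G \<turnstile> a \<^bold>: A\<rbrakk> \<Longrightarrow> G \<turnstile> App (Lam A b) a \<doteq> inst b a \<^bold>: inst B a"
| eta: "G \<turnstile> f \<^bold>: Pi A B \<Longrightarrow> G \<turnstile> Lam A (App (f \<up> 1) (Var 0)) \<doteq> f \<^bold>: Pi A B"

\<comment> \<open>dependent sums\<close>
| t_sig: "\<lbrakk>G \<turnstile> A \<^bold>: Univ i; A # G \<turnstile> B \<^bold>: Univ j\<rbrakk> \<Longrightarrow> G \<turnstile> Sig A B \<^bold>: Univ (max i j)"
| t_pair: "\<lbrakk>A # G \<turnstile> B \<^bold>: Univ j; G \<turnstile> a \<^bold>: A; G \<turnstile> b \<^bold>: inst B a\<rbrakk> \<Longrightarrow> G \<turnstile> Pr a b \<^bold>: Sig A B"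
| t_fst: "G \<turnstile> p \<^bold>: Sig A B \<Longrightarrow> G \<turnstile> Fst p \<^bold>: A"
| t_snd: "G \<turnstile> p \<^bold>: Sig A B \<Longrightarrow> G \<turnstile> Snd p \<^bold>: inst B (Fst p)"
| t_sigind: "\<lbrakk>Sig A B # G \<turnstile> C \<^bold>: Univ k; B # A # G \<turnstile> g \<^bold>: pull 2 C (Pr (Var 1) (Var 0));
     G \<turnstile> p \<^bold>: Sig A B\<rbrakk> \<Longrightarrow> G \<turnstile> SigInd C g p \<^bold>: inst C p"
| e_sig: "\<lbrakk>G \<turnstile> A \<doteq> A' \<^bold>: Univ i; A # G \<turnstile> B \<doteq> B' \<^bold>: Univ j\<rbrakk>
    \<Longrightarrow> G \<turnstile> Sig A B \<doteq> Sig A' B' \<^bold>: Univ (max i j)"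
| e_sigind: "\<lbrakk>Sig A B # G \<turnstile> C \<doteq> C' \<^bold>: Univ k;
     B # A # G \<turnstile> g \<doteq> g' \<^bold>: pull 2 C (Pr (Var 1) (Var 0)); G \<turnstile> p \<^bold>: Sig A B\<rbrakk>
    \<Longrightarrow> G \<turnstile> SigInd C g p \<doteq> SigInd C' g' p \<^bold>: inst C p"
| fst_pair: "\<lbrakk>A # G \<turnstile> B \<^bold>: Univ j; G \<turnstile> a \<^bold>: A; G \<turnstile> b \<^bold>: inst B a\<rbrakk>
    \<Longrightarrow> G \<turnstile> Fst (Pr a b) \<doteq> a \<^bold>: A"
| snd_pair: "\<lbrakk>A # G \<turnstile> B \<^bold>: Univ j; G \<turnstile> a \<^bold>: A; G \<turnstile> b \<^bold>: inst B a\<rbrakk>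
    \<Longrightarrow> G \<turnstile> Snd (Pr a b) \<doteq> b \<^bold>: inst B a"
| sigind_pair: "\<lbrakk>Sig A B # G \<turnstile> C \<^bold>: Univ k; B # A # G \<turnstile> g \<^bold>: pull 2 C (Pr (Var 1) (Var 0));
     G \<turnstile> a \<^bold>: A; G \<turnstile> b \<^bold>: inst B a\<rbrakk>
    \<Longrightarrow> G \<turnstile> SigInd C g (Pr a b) \<doteq> inst2 g a b \<^bold>: inst C (Pr a b)"

\<comment> \<open>binary sums\<close>
| t_plus: "\<lbrakk>G \<turnstile> A \<^bold>: Univ i; G \<turnstile> B \<^bold>: Univ j\<rbrakk> \<Longrightarrow> G \<turnstile> Plus A B \<^bold>: Univ (max i j)"
| t_inl: "\<lbrakk>G \<turnstile> a \<^bold>: A; G \<turnstile> B \<^bold>: Univ j\<rbrakk> \<Longrightarrow> G \<turnstile> InL a \<^bold>: Plus A B"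
| t_inr: "\<lbrakk>G \<turnstile> A \<^bold>: Univ i; G \<turnstile> b \<^bold>: B\<rbrakk> \<Longrightarrow> G \<turnstile> InR b \<^bold>: Plus A B"
| t_plusind: "\<lbrakk>Plus A B # G \<turnstile> C \<^bold>: Univ k; A # G \<turnstile> c \<^bold>: pull 1 C (InL (Var 0));
     B # G \<turnstile> d \<^bold>: pull 1 C (InR (Var 0)); G \<turnstile> s \<^bold>: Plus A B\<rbrakk>
    \<Longrightarrow> G \<turnstile> PlusInd C c d s \<^bold>: inst C s"
| e_plusind: "\<lbrakk>Plus A B # G \<turnstile> C \<doteq> C' \<^bold>: Univ k; A # G \<turnstile> c \<doteq> c' \<^bold>: pull 1 C (InL (Var 0));
     B # G \<turnstile> d \<doteq> d' \<^bold>: pull 1 C (InR (Var 0)); G \<turnstile> s \<^bold>: Plus A B\<rbrakk>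
    \<Longrightarrow> G \<turnstile> PlusInd C c d s \<doteq> PlusInd C' c' d' s \<^bold>: inst C s"
| plusind_inl: "\<lbrakk>Plus A B # G \<turnstile> C \<^bold>: Univ k; A # G \<turnstile> c \<^bold>: pull 1 C (InL (Var 0));
     B # G \<turnstile> d \<^bold>: pull 1 C (InR (Var 0)); G \<turnstile> a \<^bold>: A\<rbrakk>
    \<Longrightarrow> G \<turnstile> PlusInd C c d (InL a) \<doteq> inst c a \<^bold>: inst C (InL a)"
| plusind_inr: "\<lbrakk>Plus A B # G \<turnstile> C \<^bold>: Univ k; A # G \<turnstile> c \<^bold>: pull 1 C (InL (Var 0));
     B # G \<turnstile> d \<^bold>: pull 1 C (InR (Var 0)); G \<turnstile> b \<^bold>: B\<rbrakk>
    \<Longrightarrow> G \<turnstile> PlusInd C c d (InR b) \<doteq> inst d b \<^bold>: inst C (InR b)"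

\<comment> \<open>empty and unit types\<close>
| t_empty: "wf_ctx G \<Longrightarrow> G \<turnstile> Empty i \<^bold>: Univ i"
| t_emptyind: "\<lbrakk>Empty i # G \<turnstile> C \<^bold>: Univ k; G \<turnstile> e \<^bold>: Empty i\<rbrakk> \<Longrightarrow> G \<turnstile> EmptyInd C e \<^bold>: inst C e"
| e_emptyind: "\<lbrakk>Empty i # G \<turnstile> C \<doteq> C' \<^bold>: Univ k; G \<turnstile> e \<^bold>: Empty i\<rbrakk>
    \<Longrightarrow> G \<turnstile> EmptyInd C e \<doteq> EmptyInd C' e \<^bold>: inst C e"
| t_unit: "wf_ctx G \<Longrightarrow> G \<turnstile> Unit i \<^bold>: Univ i"
| t_star: "wf_ctx G \<Longrightarrow> G \<turnstile> Star i \<^bold>: Unit i"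
| t_unitind: "\<lbrakk>Unit i # G \<turnstile> C \<^bold>: Univ k; G \<turnstile> c \<^bold>: inst C (Star i); G \<turnstile> s \<^bold>: Unit i\<rbrakk>
    \<Longrightarrow> G \<turnstile> UnitInd C c s \<^bold>: inst C s"
| e_unitind: "\<lbrakk>Unit i # G \<turnstile> C \<doteq> C' \<^bold>: Univ k; G \<turnstile> c \<doteq> c' \<^bold>: inst C (Star i); G \<turnstile> s \<^bold>: Unit i\<rbrakk>
    \<Longrightarrow> G \<turnstile> UnitInd C c s \<doteq> UnitInd C' c' s \<^bold>: inst C s"
| unitind_star: "\<lbrakk>Unit i # G \<turnstile> C \<^bold>: Univ k; G \<turnstile> c \<^bold>: inst C (Star i)\<rbrakk>
    \<Longrightarrow> G \<turnstile> UnitInd C c (Star i) \<doteq> c \<^bold>: inst C (Star i)"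

\<comment> \<open>natural numbers\<close>
| t_nat: "wf_ctx G \<Longrightarrow> G \<turnstile> NatT \<^bold>: Univ 0"
| t_zero: "wf_ctx G \<Longrightarrow> G \<turnstile> Zero \<^bold>: NatT"
| t_succ: "G \<turnstile> n \<^bold>: NatT \<Longrightarrow> G \<turnstile> Succ n \<^bold>: NatT"
| t_natind: "\<lbrakk>NatT # G \<turnstile> C \<^bold>: Univ k; G \<turnstile> z \<^bold>: inst C Zero;
     C # NatT # G \<turnstile> s \<^bold>: pull 2 C (Succ (Var 1)); G \<turnstile> n \<^bold>: NatT\<rbrakk>
    \<Longrightarrow> G \<turnstile> NatInd C z s n \<^bold>: inst C n"
| e_natind: "\<lbrakk>NatT # G \<turnstile> C \<doteq> C' \<^bold>: Univ k; G \<turnstile> z \<doteq> z' \<^bold>: inst C Zero;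
     C # NatT # G \<turnstile> s \<doteq> s' \<^bold>: pull 2 C (Succ (Var 1)); G \<turnstile> n \<^bold>: NatT\<rbrakk>
    \<Longrightarrow> G \<turnstile> NatInd C z s n \<doteq> NatInd C' z' s' n \<^bold>: inst C n"
| natind_zero: "\<lbrakk>NatT # G \<turnstile> C \<^bold>: Univ k; G \<turnstile> z \<^bold>: inst C Zero;
     C # NatT # G \<turnstile> s \<^bold>: pull 2 C (Succ (Var 1))\<rbrakk>
    \<Longrightarrow> G \<turnstile> NatInd C z s Zero \<doteq> z \<^bold>: inst C Zero"
| natind_succ: "\<lbrakk>NatT # G \<turnstile> C \<^bold>: Univ k; G \<turnstile> z \<^bold>: inst C Zero;
     C # NatT # G \<turnstile> s \<^bold>: pull 2 C (Succ (Var 1)); G \<turnstile> n \<^bold>: NatT\<rbrakk>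
    \<Longrightarrow> G \<turnstile> NatInd C z s (Succ n) \<doteq> inst2 s n (NatInd C z s n) \<^bold>: inst C (Succ n)"

\<comment> \<open>identity types, with based path induction\<close>
| t_eq: "\<lbrakk>G \<turnstile> A \<^bold>: Univ i; G \<turnstile> a \<^bold>: A; G \<turnstile> b \<^bold>: A\<rbrakk> \<Longrightarrow> G \<turnstile> Eq A a b \<^bold>: Univ i"
| t_rfl: "G \<turnstile> a \<^bold>: A \<Longrightarrow> G \<turnstile> Rfl a \<^bold>: Eq A a a"
| t_j: "\<lbrakk>Eq (A \<up> 1) (a \<up> 1) (Var 0) # A # G \<turnstile> C \<^bold>: Univ k; G \<turnstile> d \<^bold>: inst2 C a (Rfl a);
     G \<turnstile> b \<^bold>: A; G \<turnstile> p \<^bold>: Eq A a b\<rbrakk> \<Longrightarrow> G \<turnstile> J C d b p \<^bold>: inst2 C b p"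
| e_j: "\<lbrakk>Eq (A \<up> 1) (a \<up> 1) (Var 0) # A # G \<turnstile> C \<doteq> C' \<^bold>: Univ k;
     G \<turnstile> d \<doteq> d' \<^bold>: inst2 C a (Rfl a); G \<turnstile> b \<^bold>: A; G \<turnstile> p \<^bold>: Eq A a b\<rbrakk>
    \<Longrightarrow> G \<turnstile> J C d b p \<doteq> J C' d' b p \<^bold>: inst2 C b p"
| j_rfl: "\<lbrakk>Eq (A \<up> 1) (a \<up> 1) (Var 0) # A # G \<turnstile> C \<^bold>: Univ k; G \<turnstile> a \<^bold>: A;
     G \<turnstile> d \<^bold>: inst2 C a (Rfl a)\<rbrakk>
    \<Longrightarrow> G \<turnstile> J C d a (Rfl a) \<doteq> d \<^bold>: inst2 C a (Rfl a)"

\<comment> \<open>propositional truncation\<close>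
| t_trunc: "G \<turnstile> A \<^bold>: Univ i \<Longrightarrow> G \<turnstile> Trunc A \<^bold>: Univ i"
| t_trin: "G \<turnstile> a \<^bold>: A \<Longrightarrow> G \<turnstile> TrIn a \<^bold>: Trunc A"
| t_treq: "\<lbrakk>G \<turnstile> a \<^bold>: Trunc A; G \<turnstile> b \<^bold>: Trunc A\<rbrakk> \<Longrightarrow> G \<turnstile> TrEq a b \<^bold>: Eq (Trunc A) a b"
| t_trrec: "\<lbrakk>G \<turnstile> P \<^bold>: Univ k; G \<turnstile> h \<^bold>: is_prop P; G \<turnstile> f \<^bold>: arrow A P; G \<turnstile> a \<^bold>: Trunc A\<rbrakk>
    \<Longrightarrow> G \<turnstile> TrRec P h f a \<^bold>: P"

\<comment> \<open>function and propositional extensionality\<close>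
| t_funext: "\<lbrakk>G \<turnstile> f \<^bold>: Pi A B; G \<turnstile> g \<^bold>: Pi A B;
     G \<turnstile> h \<^bold>: Pi A (Eq B (App (f \<up> 1) (Var 0)) (App (g \<up> 1) (Var 0)))\<rbrakk>
    \<Longrightarrow> G \<turnstile> FunExt f g h \<^bold>: Eq (Pi A B) f g"
| t_propext: "\<lbrakk>G \<turnstile> P \<^bold>: Univ i; G \<turnstile> Q \<^bold>: Univ i; G \<turnstile> h \<^bold>: is_prop P; G \<turnstile> k \<^bold>: is_prop Q;
     G \<turnstile> f \<^bold>: arrow P Q; G \<turnstile> g \<^bold>: arrow Q P\<rbrakk>
    \<Longrightarrow> G \<turnstile> PropExt P Q h k f g \<^bold>: Eq (Univ i) P Q"


section \<open>A notation for closed types with named variables\<close>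

text \<open>
  To write types without index arithmetic, an expression is a function from the
  number of enclosing binders to a raw term. A binder at depth \<open>d\<close> hands to its body the variable
  it introduces, whose index at a depth \<open>d' > d\<close> is \<open>d' - Suc d\<close>. A closed expression \<open>A\<close> denotes
  the raw term \<open>A 0\<close>.
\<close>

type_synonym expr = "nat \<Rightarrow> tm"

definition bound :: "nat \<Rightarrow> expr" where
  "bound d = (\<lambda>d'. Var (d' - Suc d))"

definition PI :: "expr \<Rightarrow> (expr \<Rightarrow> expr) \<Rightarrow> expr" where
  "PI A B = (\<lambda>d. Pi (A d) (B (bound d) (Suc d)))"

definition SG :: "expr \<Rightarrow> (expr \<Rightarrow> expr) \<Rightarrow> expr" where
  "SG A B = (\<lambda>d. Sig (A d) (B (bound d) (Suc d)))"

definition LM :: "expr \<Rightarrow> (expr \<Rightarrow> expr) \<Rightarrow> expr" where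
  "LM A b = (\<lambda>d. Lam (A d) (b (bound d) (Suc d)))"

definition AP :: "expr \<Rightarrow> expr \<Rightarrow> expr"  (infixl "\<cdot>" 90) where
  "f \<cdot> a = (\<lambda>d. App (f d) (a d))"

definition FST :: "expr \<Rightarrow> expr" where
  "FST p = (\<lambda>d. Fst (p d))"

definition ARR :: "expr \<Rightarrow> expr \<Rightarrow> expr"  (infixr "\<Rrightarrow>" 55) where
  "A \<Rrightarrow> B = PI A (\<lambda>_. B)"

definition PROD :: "expr \<Rightarrow> expr \<Rightarrow> expr"  (infixr "\<otimes>" 65) where
  "A \<otimes> B = SG A (\<lambda>_. B)"

definition SUM :: "expr \<Rightarrow> expr \<Rightarrow> expr"  (infixr "\<oplus>" 60) where
  "A \<oplus> B = (\<lambda>d. Plus (A d) (B d))"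

text \<open>Case distinction with constant motive \<open>C\<close> and branches not using the injected element.\<close>

definition CASE :: "expr \<Rightarrow> expr \<Rightarrow> expr \<Rightarrow> expr \<Rightarrow> expr" where
  "CASE C x y s = (\<lambda>d. PlusInd (C (Suc d)) (x (Suc d)) (y (Suc d)) (s d))"

definition ID :: "expr \<Rightarrow> expr \<Rightarrow> expr \<Rightarrow> expr" where
  "ID A x y = (\<lambda>d. Eq (A d) (x d) (y d))"

definition TYPE_OF :: "nat \<Rightarrow> expr" where
  "TYPE_OF i = (\<lambda>d. Univ i)"

definition ONE :: "nat \<Rightarrow> expr" where
  "ONE i = (\<lambda>d. Unit i)"

definition NEG :: "expr \<Rightarrow> expr" where
  "NEG A = A \<Rrightarrow> (\<lambda>d. Empty 0)"

definition EXISTS :: "expr \<Rightarrow> (expr \<Rightarrow> expr) \<Rightarrow> expr" where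
  "EXISTS A B = (\<lambda>d. Trunc (SG A B d))"

definition IFF :: "expr \<Rightarrow> expr \<Rightarrow> expr" where
  "IFF A B = (A \<Rrightarrow> B) \<otimes> (B \<Rrightarrow> A)"

definition is_proposition :: "expr \<Rightarrow> expr" where
  "is_proposition A = PI A (\<lambda>x. PI A (\<lambda>y. ID A x y))"

text \<open>Equivalences are the maps with a section and a retraction.\<close>

definition EQUIV :: "expr \<Rightarrow> expr \<Rightarrow> expr" where
  "EQUIV A B = SG (A \<Rrightarrow> B) (\<lambda>f.
     SG (B \<Rrightarrow> A) (\<lambda>g. PI B (\<lambda>b. ID B (f \<cdot> (g \<cdot> b)) b)) \<otimes>
     SG (B \<Rrightarrow> A) (\<lambda>g. PI A (\<lambda>a. ID A (g \<cdot> (f \<cdot> a)) a)))"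

definition provable :: "expr \<Rightarrow> bool" where
  "provable A \<longleftrightarrow> (\<exists>e. [] \<turnstile> e \<^bold>: A 0)"


section \<open>Posets\<close>

text \<open>In what follows \<open>X\<close> is the carrier, \<open>R\<close> the order relation, \<open>v\<close> the universe level of \<open>\<V>\<close>.\<close>

definition prop_valued :: "expr \<Rightarrow> expr \<Rightarrow> expr" where
  "prop_valued X R = PI X (\<lambda>x. PI X (\<lambda>y. is_proposition (R \<cdot> x \<cdot> y)))"

definition reflexive :: "expr \<Rightarrow> expr \<Rightarrow> expr" where
  "reflexive X R = PI X (\<lambda>x. R \<cdot> x \<cdot> x)"

definition transitive :: "expr \<Rightarrow> expr \<Rightarrow> expr" where
  "transitive X R = PI X (\<lambda>x. PI X (\<lambda>y. PI X (\<lambda>z.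
     R \<cdot> x \<cdot> y \<Rrightarrow> R \<cdot> y \<cdot> z \<Rrightarrow> R \<cdot> x \<cdot> z)))"

definition antisymmetric :: "expr \<Rightarrow> expr \<Rightarrow> expr" where
  "antisymmetric X R = PI X (\<lambda>x. PI X (\<lambda>y. R \<cdot> x \<cdot> y \<Rrightarrow> R \<cdot> y \<cdot> x \<Rrightarrow> ID X x y))"

definition is_sup :: "expr \<Rightarrow> expr \<Rightarrow> expr \<Rightarrow> expr \<Rightarrow> expr \<Rightarrow> expr" where
  "is_sup X R I \<alpha> s =
     PI I (\<lambda>i. R \<cdot> (\<alpha> \<cdot> i) \<cdot> s) \<otimes>
     PI X (\<lambda>w. PI I (\<lambda>i. R \<cdot> (\<alpha> \<cdot> i) \<cdot> w) \<Rrightarrow> R \<cdot> s \<cdot> w)"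

definition delta :: "nat \<Rightarrow> expr \<Rightarrow> expr \<Rightarrow> expr \<Rightarrow> expr \<Rightarrow> expr" where
  "delta v X x y P = LM (ONE v \<oplus> P) (\<lambda>i. CASE X x y i)"

definition delta_complete :: "nat \<Rightarrow> expr \<Rightarrow> expr \<Rightarrow> expr" where
  "delta_complete v X R = PI X (\<lambda>x. PI X (\<lambda>y. R \<cdot> x \<cdot> y \<Rrightarrow>
     PI (TYPE_OF v) (\<lambda>P. is_proposition P \<Rrightarrow>
       SG X (\<lambda>s. is_sup X R (ONE v \<oplus> P) (delta v X x y P) s))))"

text \<open>
  The supremum of \<open>\<delta>\<^bsub>x,y,P\<^esub>\<close> provided by a completeness witness \<open>c\<close>, where \<open>l\<close> proves that
  \<open>x\<close> is below \<open>y\<close> and \<open>h\<close> that \<open>P\<close> is a proposition.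
\<close>

definition sup_delta :: "expr \<Rightarrow> expr \<Rightarrow> expr \<Rightarrow> expr \<Rightarrow> expr \<Rightarrow> expr \<Rightarrow> expr" where
  "sup_delta c x y l P h = FST (c \<cdot> x \<cdot> y \<cdot> l \<cdot> P \<cdot> h)"

text \<open>\<open>tr\<close> is the proof of transitivity, needed to form the supremum of \<open>\<delta>\<^bsub>x,z,P\<^esub>\<close>.\<close>

definition strictly_below ::
  "nat \<Rightarrow> expr \<Rightarrow> expr \<Rightarrow> expr \<Rightarrow> expr \<Rightarrow> expr \<Rightarrow> expr \<Rightarrow> expr" where
  "strictly_below v X R tr c x y = SG (R \<cdot> x \<cdot> y) (\<lambda>l.
     PI X (\<lambda>z. PI (R \<cdot> y \<cdot> z) (\<lambda>m. PI (TYPE_OF v) (\<lambda>P. PI (is_proposition P) (\<lambda>h.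
       ID X z (sup_delta c x z (tr \<cdot> x \<cdot> y \<cdot> z \<cdot> l \<cdot> m) P h) \<Rrightarrow> P)))))"

definition nontrivial :: "expr \<Rightarrow> expr \<Rightarrow> expr" where
  "nontrivial X R = EXISTS X (\<lambda>x. EXISTS X (\<lambda>y. R \<cdot> x \<cdot> y \<otimes> NEG (ID X x y)))"

definition positive :: "nat \<Rightarrow> expr \<Rightarrow> expr \<Rightarrow> expr \<Rightarrow> expr \<Rightarrow> expr" where
  "positive v X R tr c = EXISTS X (\<lambda>x. EXISTS X (\<lambda>y. strictly_below v X R tr c x y))"

definition locally_small :: "nat \<Rightarrow> expr \<Rightarrow> expr \<Rightarrow> expr" where
  "locally_small v X R = SG (X \<Rrightarrow> X \<Rrightarrow> TYPE_OF v) (\<lambda>S.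
     PI X (\<lambda>x. PI X (\<lambda>y. EQUIV (R \<cdot> x \<cdot> y) (S \<cdot> x \<cdot> y))))"

definition decidable_equality :: "expr \<Rightarrow> expr" where
  "decidable_equality X = PI X (\<lambda>x. PI X (\<lambda>y. ID X x y \<oplus> NEG (ID X x y)))"

text \<open>
  There is a locally small \<open>\<delta>\<^bsub>\<V>\<^esub>\<close>-complete poset with decidable equality, with carrier in universe
  \<open>u\<close> and order relation valued in universe \<open>t\<close>, satisfying \<open>Q\<close>. The property \<open>Q\<close> may refer to
  carrier, order, transitivity proof and completeness witness.
\<close>

definition exists_poset ::
  "nat \<Rightarrow> nat \<Rightarrow> nat \<Rightarrow> (expr \<Rightarrow> expr \<Rightarrow> expr \<Rightarrow> expr \<Rightarrow> expr) \<Rightarrow> expr" where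
  "exists_poset u t v Q =
     EXISTS (TYPE_OF u) (\<lambda>X. SG (X \<Rrightarrow> X \<Rrightarrow> TYPE_OF t) (\<lambda>R.
       prop_valued X R \<otimes> reflexive X R \<otimes>
       SG (transitive X R) (\<lambda>tr. antisymmetric X R \<otimes>
       SG (delta_complete v X R) (\<lambda>c.
         locally_small v X R \<otimes> decidable_equality X \<otimes> Q X R tr c))))"

definition excluded_middle :: "nat \<Rightarrow> expr" where
  "excluded_middle v = PI (TYPE_OF v) (\<lambda>P. is_proposition P \<Rrightarrow> P \<oplus> NEG P)"

definition weak_excluded_middle :: "nat \<Rightarrow> expr" where
  "weak_excluded_middle v = PI (TYPE_OF v) (\<lambda>P. is_proposition P \<Rrightarrow> NEG P \<oplus> NEG (NEG P))"

end

theory Submission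
  imports Defs "HOL-Library.Monad_Syntax"
begin

text \<open>
  Let \<open>s\<close> be the supremum of \<open>\<delta>\<^bsub>x,y,P\<^esub>\<close>. If \<open>x \<sqsubseteq> y\<close> and \<open>x \<noteq> y\<close>, then \<open>s = x\<close> refutes \<open>P\<close>, and
  \<open>s \<noteq> x\<close> refutes \<open>\<not> P\<close>; if \<open>x\<close> is strictly below \<open>y\<close>, then \<open>s = y\<close> yields \<open>P\<close>, and \<open>s \<noteq> y\<close>
  refutes \<open>P\<close>. So decidable equality decides \<open>\<not> P\<close>, respectively \<open>P\<close>; as the (weak) excluded middle is
  a proposition by function extensionality, the truncations can be eliminated. Conversely, in a poset
  with decidable order the supremum of \<open>\<delta>\<^bsub>x,y,P\<^esub>\<close> is \<open>x\<close> if \<open>\<not> P\<close> and \<open>y\<close> if \<open>\<not> \<not> P\<close>, and the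
  two-element poset is such a poset; with excluded middle its bottom is strictly below its top.

  Derivability of the types in question is established by exhibiting proof terms and running a sound
  bidirectional type checker on them. The checker compares types syntactically. Judgmental computation
  enters only through three types of the form \<open>lhs = rhs\<close> that are inhabited by reflexivity
  (\<open>case_inl\<close>, \<open>case_inr\<close>, \<open>beta_rel\<close>); all other terms transport along these equations.
\<close>


section \<open>Renaming and substitution\<close>

text \<open>
  Closed forms of the iterates of \<open>up_ren\<close> and \<open>up_sub\<close>, so that the simplifier computes renamings
  and substitutions under binders without building up nested functions.
\<close>

definition shift_at :: "nat \<Rightarrow> nat \<Rightarrow> nat \<Rightarrow> nat" where
  "shift_at k n i = (if i < k then i else i + n)"

definition sub_at :: "nat \<Rightarrow> (nat \<Rightarrow> tm) \<Rightarrow> nat \<Rightarrow> tm" where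
  "sub_at k s i = (if i < k then Var i else s (i - k) \<up> k)"

lemma lift_eq: "t \<up> n = ren (shift_at 0 n) t"
  by (simp add: lift_def shift_at_def[abs_def])

lemma up_shift_at: "up_ren (shift_at k n) = shift_at (Suc k) n"
proof
  fix i show "up_ren (shift_at k n) i = shift_at (Suc k) n i"
    by (cases i) (auto simp: up_ren_def shift_at_def)
qed

section \<open>Fusion laws for renaming and substitution\<close>

lemma up_ren_comp: "up_ren r \<circ> up_ren q = up_ren (r \<circ> q)"
proof
  fix i show "(up_ren r \<circ> up_ren q) i = up_ren (r \<circ> q) i"
    by (cases i) (auto simp: up_ren_def)
qed

lemma up_sub_comp: "up_sub s \<circ> up_ren r = up_sub (s \<circ> r)"
proof
  fix i show "(up_sub s \<circ> up_ren r) i = up_sub (s \<circ> r) i"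
    by (cases i) (auto simp: up_ren_def up_sub_def)
qed

lemma up_sub_Var: "up_sub Var = Var"
proof
  fix i show "up_sub Var i = Var i"
    by (cases i) (auto simp: up_sub_def lift_def)
qed

lemma ren_ren: "ren r (ren q t) = ren (r \<circ> q) t"
  by (induction t arbitrary: r q) (auto simp: up_ren_comp)

lemma sub_ren: "sub s (ren r t) = sub (s \<circ> r) t"
  by (induction t arbitrary: s r) (auto simp: up_sub_comp)

lemma sub_Var: "sub Var t = t"
  by (induction t) (auto simp: up_sub_Var)

lemma up_sub_Var_comp: "up_sub (Var \<circ> r) = Var \<circ> up_ren r"
proof
  fix i show "up_sub (Var \<circ> r) i = (Var \<circ> up_ren r) i"
    by (cases i) (auto simp: up_sub_def up_ren_def lift_def)
qed

lemma ren_eq_sub: "ren r t = sub (Var \<circ> r) t"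
  by (induction t arbitrary: r) (auto simp: up_sub_Var_comp)

lemma lift_0: "t \<up> 0 = t"
  by (simp add: lift_def ren_eq_sub comp_def sub_Var)

lemma lift_lift: "t \<up> m \<up> n = t \<up> (m + n)"
  by (simp add: lift_def ren_ren comp_def add.assoc)

text \<open>\<open>up_sub\<close> weakens once more what \<open>sub_at k\<close> has already
  weakened by \<open>k\<close>; by \<open>lift_lift\<close> the two weakenings merge.\<close>

lemma up_sub_at: "up_sub (sub_at k s) = sub_at (Suc k) s"
proof
  fix i show "up_sub (sub_at k s) i = sub_at (Suc k) s i"
    by (cases i) (auto simp: up_sub_def sub_at_def lift_lift, simp add: lift_def)
qed

lemma sub_at_0: "sub_at 0 s = s"
  by (simp add: sub_at_def[abs_def] lift_0)

lemma inst_lift: "inst (t \<up> 1) a = t"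
  by (simp add: inst_def lift_def sub_ren comp_def sub_Var)

text \<open>The rules of the calculus speak of \<open>inst\<close>, \<open>inst2\<close> and
  \<open>pull\<close>, the checker of \<open>sub_at 0\<close>. These three equations translate
  between them, and \<open>up_sub_at\<close> then handles every binder.\<close>

lemma inst_eq: "inst b a = sub (sub_at 0 (scons a Var)) b"
  by (simp add: inst_def sub_at_0)

lemma inst2_eq: "inst2 b a c = sub (sub_at 0 (scons c (scons a Var))) b"
  by (simp add: inst2_def sub_at_0)

lemma pull_eq: "pull n C a = sub (sub_at 0 (scons a (\<lambda>i. Var (i + n)))) C"
  by (simp add: pull_def sub_at_0)


section \<open>A sound type checker\<close>

text \<open>Keeps a derivation for every entry. The rule for \<open>wf_ctx\<close> mentions only the
  latest one, and recovering the others would take an inversion argument.\<close>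

primrec ok_ctx :: "tm list \<Rightarrow> bool" where
  "ok_ctx [] = True"
| "ok_ctx (A # G) = (ok_ctx G \<and> (\<exists>i. G \<turnstile> A \<^bold>: Univ i))"

lemma ok_ctx_imp_wf: "ok_ctx G \<Longrightarrow> wf_ctx G"
  by (cases G) (auto intro: wf_nil wf_cons)

text \<open>\<open>t_var\<close> serves the head and \<open>t_weak\<close> each step past a newer
  entry; the shifts add up.\<close>

lemma t_lookup: "\<lbrakk>ok_ctx G; i < length G\<rbrakk> \<Longrightarrow> G \<turnstile> Var i \<^bold>: ren (shift_at 0 (Suc i)) (G ! i)"
  unfolding lift_eq[symmetric]
proof (induction G arbitrary: i)
  case (Cons A G)
  then obtain j where A: "G \<turnstile> A \<^bold>: Univ j"
    by auto
  show ?case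
  proof (cases i)
    case 0
    then show ?thesis using t_var[OF A] by simp
  next
    case (Suc k)
    then have "G \<turnstile> Var k \<^bold>: (G ! k) \<up> Suc k"
      using Cons by auto
    from t_weak[OF this A] show ?thesis
      using Suc by (simp add: lift_lift) (simp add: lift_def)
  qed
qed simp

section \<open>Recognition of type formers, passing on failure of inference\<close>

fun dest_univ :: "tm option \<Rightarrow> nat option" where
  "dest_univ (Some (Univ i)) = Some i"
| "dest_univ _ = None"

fun dest_pi :: "tm option \<Rightarrow> (tm \<times> tm) option" where
  "dest_pi (Some (Pi A B)) = Some (A, B)"
| "dest_pi _ = None"

fun dest_sig :: "tm option \<Rightarrow> (tm \<times> tm) option" where
  "dest_sig (Some (Sig A B)) = Some (A, B)"
| "dest_sig _ = None"

fun dest_plus :: "tm option \<Rightarrow> (tm \<times> tm) option" where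
  "dest_plus (Some (Plus A B)) = Some (A, B)"
| "dest_plus _ = None"

fun dest_empty :: "tm option \<Rightarrow> nat option" where
  "dest_empty (Some (Empty i)) = Some i"
| "dest_empty _ = None"

fun dest_unit :: "tm option \<Rightarrow> nat option" where
  "dest_unit (Some (Unit i)) = Some i"
| "dest_unit _ = None"

fun dest_eq :: "tm option \<Rightarrow> (tm \<times> tm \<times> tm) option" where
  "dest_eq (Some (Eq A a b)) = Some (A, a, b)"
| "dest_eq _ = None"

fun dest_trunc :: "tm option \<Rightarrow> tm option" where
  "dest_trunc (Some (Trunc A)) = Some A"
| "dest_trunc _ = None"

lemma dest_eq_Some:
  "dest_univ T = Some i \<longleftrightarrow> T = Some (Univ i)"
  "dest_pi T = Some (A, B) \<longleftrightarrow> T = Some (Pi A B)"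
  "dest_sig T = Some (A, B) \<longleftrightarrow> T = Some (Sig A B)"
  "dest_plus T = Some (A, B) \<longleftrightarrow> T = Some (Plus A B)"
  "dest_empty T = Some i \<longleftrightarrow> T = Some (Empty i)"
  "dest_unit T = Some i \<longleftrightarrow> T = Some (Unit i)"
  "dest_eq T = Some (A, a, b) \<longleftrightarrow> T = Some (Eq A a b)"
  "dest_trunc T = Some A \<longleftrightarrow> T = Some (Trunc A)"
  by (auto elim: dest_univ.elims dest_pi.elims dest_sig.elims dest_plus.elims dest_empty.elims
      dest_unit.elims dest_eq.elims dest_trunc.elims)

definition guard :: "bool \<Rightarrow> unit option" where
  "guard b = (if b then Some () else None)"

text \<open>
  The first argument bounds the recursion depth; the recursion is not structural because the types
  inferred for subterms are checked in turn.
\<close>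

fun infer :: "nat \<Rightarrow> tm list \<Rightarrow> tm \<Rightarrow> tm option"
  and check :: "nat \<Rightarrow> tm list \<Rightarrow> tm \<Rightarrow> tm \<Rightarrow> unit option" where
  "infer (Suc n) G (Var i) = do {
     guard (i < length G);
     Some (ren (shift_at 0 (Suc i)) (G ! i)) }"
| "infer (Suc n) G (Univ i) = Some (Univ (Suc i))"
| "infer (Suc n) G (Pi A B) = do {
     i \<leftarrow> dest_univ (infer n G A);
     j \<leftarrow> dest_univ (infer n (A # G) B);
     Some (Univ (max i j)) }"
| "infer (Suc n) G (Sig A B) = do {
     i \<leftarrow> dest_univ (infer n G A);
     j \<leftarrow> dest_univ (infer n (A # G) B);
     Some (Univ (max i j)) }"
| "infer (Suc n) G (Plus A B) = do {
     i \<leftarrow> dest_univ (infer n G A);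
     j \<leftarrow> dest_univ (infer n G B);
     Some (Univ (max i j)) }"
| "infer (Suc n) G (Lam A b) = do {
     i \<leftarrow> dest_univ (infer n G A);
     B \<leftarrow> infer n (A # G) b;
     Some (Pi A B) }"
| "infer (Suc n) G (App f a) = do {
     (A, B) \<leftarrow> dest_pi (infer n G f);
     check n G a A;
     Some (sub (sub_at 0 (scons a Var)) B) }"
| "infer (Suc n) G (Fst p) = do {
     (A, B) \<leftarrow> dest_sig (infer n G p);
     Some A }"
| "infer (Suc n) G (Snd p) = do {
     (A, B) \<leftarrow> dest_sig (infer n G p);
     Some (sub (sub_at 0 (scons (Fst p) Var)) B) }"
| "infer (Suc n) G (SigInd C g p) = do {
     (A, B) \<leftarrow> dest_sig (infer n G p);
     i \<leftarrow> dest_univ (infer n G A);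
     j \<leftarrow> dest_univ (infer n (A # G) B);
     k \<leftarrow> dest_univ (infer n (Sig A B # G) C);
     check n (B # A # G) g
       (sub (sub_at 0 (scons (Pr (Var (Suc 0)) (Var 0)) (\<lambda>i. Var (Suc (Suc i))))) C);
     Some (sub (sub_at 0 (scons p Var)) C) }"
| "infer (Suc n) G (PlusInd C c d s) = do {
     (A, B) \<leftarrow> dest_plus (infer n G s);
     i \<leftarrow> dest_univ (infer n G A);
     j \<leftarrow> dest_univ (infer n G B);
     k \<leftarrow> dest_univ (infer n (Plus A B # G) C);
     check n (A # G) c (sub (sub_at 0 (scons (InL (Var 0)) (\<lambda>i. Var (Suc i)))) C);
     check n (B # G) d (sub (sub_at 0 (scons (InR (Var 0)) (\<lambda>i. Var (Suc i)))) C);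
     Some (sub (sub_at 0 (scons s Var)) C) }"
| "infer (Suc n) G (Empty i) = Some (Univ i)"
| "infer (Suc n) G (EmptyInd C e) = do {
     i \<leftarrow> dest_empty (infer n G e);
     k \<leftarrow> dest_univ (infer n (Empty i # G) C);
     Some (sub (sub_at 0 (scons e Var)) C) }"
| "infer (Suc n) G (Unit i) = Some (Univ i)"
| "infer (Suc n) G (Star i) = Some (Unit i)"
| "infer (Suc n) G (UnitInd C c s) = do {
     i \<leftarrow> dest_unit (infer n G s);
     k \<leftarrow> dest_univ (infer n (Unit i # G) C);
     check n G c (sub (sub_at 0 (scons (Star i) Var)) C);
     Some (sub (sub_at 0 (scons s Var)) C) }"
| "infer (Suc n) G (Eq A a b) = do {
     i \<leftarrow> dest_univ (infer n G A);
     check n G a A;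
     check n G b A;
     Some (Univ i) }"
| "infer (Suc n) G (J C d b p) = do {
     (A, a, b') \<leftarrow> dest_eq (infer n G p);
     guard (b = b');
     i \<leftarrow> dest_univ (infer n G A);
     check n G a A;
     check n G b A;
     k \<leftarrow> dest_univ
       (infer n (Eq (ren (shift_at 0 (Suc 0)) A) (ren (shift_at 0 (Suc 0)) a) (Var 0) # A # G) C);
     check n G d (sub (sub_at 0 (scons (Rfl a) (scons a Var))) C);
     Some (sub (sub_at 0 (scons p (scons b Var))) C) }"
| "infer (Suc n) G (Trunc A) = do {
     i \<leftarrow> dest_univ (infer n G A);
     Some (Univ i) }"
| "infer (Suc n) G (TrRec P h f a) = do {
     A \<leftarrow> dest_trunc (infer n G a);
     k \<leftarrow> dest_univ (infer n G P);
     check n G h (Pi P (Pi (ren (shift_at 0 (Suc 0)) P)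
       (Eq (ren (shift_at 0 (Suc (Suc 0))) P) (Var (Suc 0)) (Var 0))));
     check n G f (Pi A (ren (shift_at 0 (Suc 0)) P));
     Some P }"
| "infer (Suc n) G (FunExt f g h) = do {
     (A, B) \<leftarrow> dest_pi (infer n G f);
     check n G g (Pi A B);
     check n G h (Pi A (Eq B (App (ren (shift_at 0 (Suc 0)) f) (Var 0))
       (App (ren (shift_at 0 (Suc 0)) g) (Var 0))));
     Some (Eq (Pi A B) f g) }"
| "infer n G e = None"
| "check (Suc n) G (Lam A b) T = do {
     (A', B) \<leftarrow> dest_pi (Some T);
     guard (A = A');
     i \<leftarrow> dest_univ (infer n G A);
     check n (A # G) b B }"
| "check (Suc n) G (Pr a b) T = do {
     (A, B) \<leftarrow> dest_sig (Some T);
     i \<leftarrow> dest_univ (infer n G A);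
     j \<leftarrow> dest_univ (infer n (A # G) B);
     check n G a A;
     check n G b (sub (sub_at 0 (scons a Var)) B) }"
| "check (Suc n) G (InL a) T = do {
     (A, B) \<leftarrow> dest_plus (Some T);
     j \<leftarrow> dest_univ (infer n G B);
     check n G a A }"
| "check (Suc n) G (InR b) T = do {
     (A, B) \<leftarrow> dest_plus (Some T);
     i \<leftarrow> dest_univ (infer n G A);
     check n G b B }"
| "check (Suc n) G (Rfl a) T = do {
     (A, x, y) \<leftarrow> dest_eq (Some T);
     guard (x = a);
     guard (y = a);
     check n G a A }"
| "check (Suc n) G (TrIn a) T = do {
     A \<leftarrow> dest_trunc (Some T);
     check n G a A }"
| "check (Suc n) G e T = do {
     T' \<leftarrow> infer n G e;
     guard (T' = T) }"
| "check 0 G e T = None"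

lemmas checker_rules_aux =
  t_app t_fst t_snd t_sigind t_plusind t_empty t_unit t_star t_emptyind t_unitind t_eq t_rfl
  t_pi t_sig t_plus t_lam t_j t_trunc t_trin t_trrec t_funext t_univ t_pair t_inl t_inr

text \<open>Substitutions and shifts are written exactly as the clauses of the checker compute them,
  so that plain resolution matches.\<close>

lemmas checker_rules = checker_rules_aux
  [unfolded inst_eq inst2_eq pull_eq arrow_def is_prop_def lift_eq
    One_nat_def numeral_2_eq_2 add_Suc_right add_0_right]

lemma ok_ctx_ConsI: "\<lbrakk>G \<turnstile> A \<^bold>: Univ i; ok_ctx G\<rbrakk> \<Longrightarrow> ok_ctx (A # G)"
  by auto

text \<open>For the motive of \<open>J\<close>, which lives over an endpoint and a path. The
  weakening of \<open>A\<close> stays in \<open>Univ i\<close> because a universe contains no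
  variables to shift.\<close>

lemma ok_ctx_pathI:
  assumes "G \<turnstile> A \<^bold>: Univ i" "G \<turnstile> a \<^bold>: A" "ok_ctx G"
  shows "ok_ctx (Eq (ren (shift_at 0 (Suc 0)) A) (ren (shift_at 0 (Suc 0)) a) (Var 0) # A # G)"
proof -
  have "A # G \<turnstile> A \<up> 1 \<^bold>: Univ i"
    using t_weak[OF assms(1) assms(1)] by (simp add: lift_def)
  from t_eq[OF this t_weak[OF assms(2,1)] t_var[OF assms(1)]] show ?thesis
    using assms by (auto simp: lift_eq)
qed

lemma guard_eq_Some: "guard b = Some u \<longleftrightarrow> b"
  by (simp add: guard_def)

text \<open>Induction on the depth bound treats both functions at once. Each clause mirrors one
  typing rule. Types read off subterms are inferred to lie in a universe wherever a rule or a
  context extension demands it, so no separate proof that types of typed terms are well formed is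
  required.\<close>

lemma infer_check_sound:
  "(\<forall>G e T. infer n G e = Some T \<longrightarrow> ok_ctx G \<longrightarrow> G \<turnstile> e \<^bold>: T) \<and>
   (\<forall>G e T. check n G e T = Some () \<longrightarrow> ok_ctx G \<longrightarrow> G \<turnstile> e \<^bold>: T)"
proof (induction n)
  case (Suc n)
  have I: "infer n G e = Some T \<Longrightarrow> ok_ctx G \<Longrightarrow> G \<turnstile> e \<^bold>: T"
    and C: "check n G e T = Some () \<Longrightarrow> ok_ctx G \<Longrightarrow> G \<turnstile> e \<^bold>: T" for G e T
    using Suc.IH by auto
  have "G \<turnstile> e \<^bold>: T" if "infer (Suc n) G e = Some T" "ok_ctx G" for G e T
    using that
    apply (cases e; clarsimp simp: bind_eq_Some_conv guard_eq_Some dest_eq_Some)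
    \<comment> \<open>The induction hypothesis is used only where a matching run of the checker is
      among the assumptions; otherwise a typing rule applies.\<close>
    apply (assumption | (rule I C, assumption)
      | rule checker_rules t_lookup ok_ctx_pathI ok_ctx_ConsI ok_ctx_imp_wf)+
    done
  moreover have "G \<turnstile> e \<^bold>: T" if "check (Suc n) G e T = Some ()" "ok_ctx G" for G e T
    using that
    apply (cases e; clarsimp simp: bind_eq_Some_conv guard_eq_Some dest_eq_Some)
    apply (assumption | (rule I C, assumption)
      | rule checker_rules t_lookup ok_ctx_pathI ok_ctx_ConsI ok_ctx_imp_wf)+
    done
  ultimately show ?case by blast
qed simp

lemma infer_sound: "infer n G e = Some T \<Longrightarrow> ok_ctx G \<Longrightarrow> G \<turnstile> e \<^bold>: T"
  and check_sound: "check n G e T = Some () \<Longrightarrow> ok_ctx G \<Longrightarrow> G \<turnstile> e \<^bold>: T"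
  using infer_check_sound by blast+

section \<open>Running the checker by rewriting\<close>

lemma shift_at_simps:
  "shift_at 0 n i = i + n"
  "shift_at (Suc k) n 0 = 0"
  "shift_at (Suc k) n (Suc i) = Suc (shift_at k n i)"
  by (auto simp: shift_at_def)

lemma sub_at_eq: "sub_at k s i = (if i < k then Var i else ren (shift_at 0 k) (s (i - k)))"
  by (simp add: sub_at_def lift_eq)

text \<open>Universe levels are variables, so the checker is run by the simplifier.
  \<open>refl[THEN eqTrueI]\<close> settles the comparisons made by \<open>guard\<close>, and the
  laws of \<open>max\<close> give \<open>NEG A\<close> the same level as \<open>A\<close>.\<close>

lemmas eval_simps =
  infer.simps check.simps guard_def if_True if_False refl[THEN eqTrueI]
  Option.bind.simps prod.case
  dest_univ.simps dest_pi.simps dest_sig.simps dest_plus.simps dest_empty.simps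
  dest_unit.simps dest_eq.simps dest_trunc.simps
  ren.simps up_shift_at shift_at_simps sub.simps up_sub_at sub_at_eq scons.simps
  nth_Cons_0 nth_Cons_Suc list.size Suc_less_eq zero_less_Suc not_less_zero
  diff_Suc_Suc diff_0_eq_0 minus_nat.diff_0 add_Suc_right add_0_right add_Suc add_0
  max.idem max_0L max_0R

text \<open>Keeps the simplifier from evaluating a continuation before its argument is known.\<close>

lemma bind_weak_cong: "x = y \<Longrightarrow> Option.bind x f = Option.bind y f"
  by simp


section \<open>Proof terms with named variables\<close>

definition SND :: "expr \<Rightarrow> expr" where
  "SND p = (\<lambda>d. Snd (p d))"

definition PAIR :: "expr \<Rightarrow> expr \<Rightarrow> expr" where
  "PAIR a b = (\<lambda>d. Pr (a d) (b d))"

definition INL :: "expr \<Rightarrow> expr" where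
  "INL a = (\<lambda>d. InL (a d))"

definition INR :: "expr \<Rightarrow> expr" where
  "INR a = (\<lambda>d. InR (a d))"

definition RFL :: "expr \<Rightarrow> expr" where
  "RFL a = (\<lambda>d. Rfl (a d))"

definition ZERO :: "nat \<Rightarrow> expr" where
  "ZERO i = (\<lambda>d. Empty i)"

definition STAR :: "nat \<Rightarrow> expr" where
  "STAR i = (\<lambda>d. Star i)"

definition EXFALSO :: "expr \<Rightarrow> expr \<Rightarrow> expr" where
  "EXFALSO C e = (\<lambda>d. EmptyInd (C (Suc d)) (e d))"

definition UNITIND :: "(expr \<Rightarrow> expr) \<Rightarrow> expr \<Rightarrow> expr \<Rightarrow> expr" where
  "UNITIND C c s = (\<lambda>d. UnitInd (C (bound d) (Suc d)) (c d) (s d))"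

definition PLUSIND :: "(expr \<Rightarrow> expr) \<Rightarrow> (expr \<Rightarrow> expr) \<Rightarrow> (expr \<Rightarrow> expr) \<Rightarrow> expr \<Rightarrow> expr" where
  "PLUSIND C f g s = (\<lambda>d. PlusInd (C (bound d) (Suc d)) (f (bound d) (Suc d))
     (g (bound d) (Suc d)) (s d))"

text \<open>The motive is constant: pairs are only taken apart on the way to a fixed goal.\<close>

definition SPLIT :: "expr \<Rightarrow> expr \<Rightarrow> (expr \<Rightarrow> expr \<Rightarrow> expr) \<Rightarrow> expr" where
  "SPLIT C p g = (\<lambda>d. SigInd (C (Suc d)) (g (bound d) (bound (Suc d)) (Suc (Suc d))) (p d))"

text \<open>The motive of a path induction depends on the endpoint only.\<close>

definition PATHIND :: "(expr \<Rightarrow> expr) \<Rightarrow> expr \<Rightarrow> expr \<Rightarrow> expr \<Rightarrow> expr" where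
  "PATHIND C c b p = (\<lambda>d. J (C (bound d) (Suc (Suc d))) (c d) (b d) (p d))"

definition TRIN :: "expr \<Rightarrow> expr" where
  "TRIN a = (\<lambda>d. TrIn (a d))"

definition TRREC :: "expr \<Rightarrow> expr \<Rightarrow> expr \<Rightarrow> expr \<Rightarrow> (expr \<Rightarrow> expr) \<Rightarrow> expr" where
  "TRREC C h A a f = (\<lambda>d. TrRec (C d) (h d) (LM A f d) (a d))"

definition FUNEXT :: "expr \<Rightarrow> expr \<Rightarrow> expr \<Rightarrow> expr" where
  "FUNEXT f g h = (\<lambda>d. FunExt (f d) (g d) (h d))"

lemma raw_applied:
  "bound k d = Var (d - Suc k)"
  "PI A B d = Pi (A d) (B (bound d) (Suc d))"
  "SG A B d = Sig (A d) (B (bound d) (Suc d))"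
  "LM A B d = Lam (A d) (B (bound d) (Suc d))"
  "(f \<cdot> a) d = App (f d) (a d)"
  "(A \<oplus> C) d = Plus (A d) (C d)"
  "CASE A x y s d = PlusInd (A (Suc d)) (x (Suc d)) (y (Suc d)) (s d)"
  "ID A x y d = Eq (A d) (x d) (y d)"
  "TYPE_OF i d = Univ i"
  "ONE i d = Unit i"
  "EXISTS A B d = Trunc (SG A B d)"
  "FST p d = Fst (p d)"
  "SND p d = Snd (p d)"
  "PAIR a b d = Pr (a d) (b d)"
  "INL a d = InL (a d)"
  "INR a d = InR (a d)"
  "RFL a d = Rfl (a d)"
  "ZERO i d = Empty i"
  "STAR i d = Star i"
  "EXFALSO A e d = EmptyInd (A (Suc d)) (e d)"
  "UNITIND B c s d = UnitInd (B (bound d) (Suc d)) (c d) (s d)"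
  "PLUSIND B g h s d = PlusInd (B (bound d) (Suc d)) (g (bound d) (Suc d))
     (h (bound d) (Suc d)) (s d)"
  "SPLIT A p q d = SigInd (A (Suc d)) (q (bound d) (bound (Suc d)) (Suc (Suc d))) (p d)"
  "PATHIND B c b p d = J (B (bound d) (Suc (Suc d))) (c d) (b d) (p d)"
  "TRIN a d = TrIn (a d)"
  "TRREC C w A a B d = TrRec (C d) (w d) (LM A B d) (a d)"
  "FUNEXT f f' w d = FunExt (f d) (f' d) (w d)"
  by (simp_all add: bound_def PI_def SG_def LM_def AP_def SUM_def CASE_def ID_def TYPE_OF_def
      ONE_def EXISTS_def FST_def SND_def PAIR_def INL_def INR_def RFL_def ZERO_def STAR_def
      EXFALSO_def UNITIND_def PLUSIND_def SPLIT_def PATHIND_def TRIN_def TRREC_def FUNEXT_def)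

lemmas raw_simps = raw_applied ARR_def PROD_def NEG_def IFF_def is_proposition_def EQUIV_def
  prop_valued_def reflexive_def transitive_def antisymmetric_def is_sup_def delta_def
  delta_complete_def sup_delta_def strictly_below_def nontrivial_def positive_def
  locally_small_def decidable_equality_def exists_poset_def excluded_middle_def
  weak_excluded_middle_def diff_Suc_Suc minus_nat.diff_0 diff_0_eq_0

lemmas typecheck = raw_simps numeral_eq_Suc pred_numeral_simps BitM.simps One_nat_def eval_simps
  inst_eq pull_eq lift_eq

lemmas weak_congs = bind_weak_cong if_weak_cong

text \<open>The empty context is trivially \<open>ok_ctx\<close>. Depth 100 suffices for every proof
  term in what follows.\<close>

lemma provableI: "check 100 [] (e 0) (A 0) = Some () \<Longrightarrow> provable A"
  unfolding provable_def using check_sound[of 100 "[]"] by auto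

text \<open>A cut: a proven type becomes a variable of the next proof term, so that the checker sees
  only its type. The second premise expresses that \<open>B\<close> is closed. In repeated use, the
  type added last becomes the outermost binder.\<close>

lemma provable_mp:
  assumes "provable A" "\<And>e. inst (B (Suc 0)) e = B 0" "provable (A \<Rrightarrow> B)"
  shows "provable B"
proof -
  from assms(1,3) obtain e f where e: "[] \<turnstile> e \<^bold>: A 0" and f: "[] \<turnstile> f \<^bold>: (A \<Rrightarrow> B) 0"
    unfolding provable_def by auto
  have "[] \<turnstile> App f e \<^bold>: B 0"
    using t_app[OF f[unfolded ARR_def PI_def] e] assms(2) by simp
  then show ?thesis unfolding provable_def by blast
qed


section \<open>Judgmental computation as reflexivity\<close>

lemma ren_0: "ren (shift_at 0 0) t = t"
  using lift_0[of t] by (simp add: lift_eq)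

lemma ok_ctx_inferI: "\<lbrakk>infer 100 G A = Some (Univ i); ok_ctx G\<rbrakk> \<Longrightarrow> ok_ctx (A # G)"
  by (auto dest: infer_sound)

text \<open>Reflexivity has type \<open>Eq A b b\<close>, and replacing the left endpoint along the
  judgmental equality gives \<open>Eq A a b\<close>. Only here is the conversion rule
  invoked.\<close>

lemma t_rfl_conv:
  assumes "G \<turnstile> A \<^bold>: Univ i" "G \<turnstile> b \<^bold>: A" "G \<turnstile> a \<doteq> b \<^bold>: A"
  shows "G \<turnstile> Rfl b \<^bold>: Eq A a b"
proof -
  have "A # G \<turnstile> Eq (A \<up> 1) (Var 0) (b \<up> 1) \<^bold>: Univ i"
    using assms(1,2) t_weak[of G _ "Univ i"] by (intro t_eq t_weak t_var) (auto simp: lift_def)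
  \<comment> \<open>Congruence by substitution: the left endpoint is a fresh variable, replaced by
    \<open>b\<close> on one side and by \<open>a\<close> on the other.\<close>
  from e_subst[OF e_refl[OF this] e_sym[OF assms(3)]]
  have "G \<turnstile> Eq A b b \<doteq> Eq A a b \<^bold>: Univ i"
    using inst_lift[of A b] inst_lift[of A a] inst_lift[of b b] inst_lift[of b a]
    by (simp add: inst_def)
  with t_rfl[OF assms(2)] show ?thesis by (rule t_conv)
qed

text \<open>In the following contexts \<open>A\<close>, \<open>B\<close>, \<open>C\<close>, \<open>x\<close>, \<open>y\<close> have the indices 5 down to 1.\<close>

lemma case_conv:
  fixes D s :: tm and a b c m :: nat
  defines "G \<equiv> [D, Var 1, Var 0, Univ c, Univ b, Univ a]"
  assumes ok: "ok_ctx G"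
    and s: "check 100 G s (Plus (Var 5) (Var 4)) = Some ()"
    and m: "check 100 G (Var m) (Var 3) = Some ()"
    and eq: "\<lbrakk>Plus (Var 5) (Var 4) # G \<turnstile> Var 4 \<^bold>: Univ c; Var 5 # G \<turnstile> Var 3 \<^bold>: Var 4;
        Var 4 # G \<turnstile> Var 2 \<^bold>: Var 4\<rbrakk>
      \<Longrightarrow> G \<turnstile> PlusInd (Var 4) (Var 3) (Var 2) s \<doteq> Var m \<^bold>: Var 3"
  shows "G \<turnstile> Rfl (Var m) \<^bold>: Eq (Var 3)
    (App (Lam (Plus (Var 5) (Var 4)) (PlusInd (Var 5) (Var 4) (Var 3) (Var 0))) s) (Var m)"
proof -
  have ok': "ok_ctx (Plus (Var 5) (Var 4) # G)" "ok_ctx (Var 5 # G)" "ok_ctx (Var 4 # G)"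
    by (rule ok_ctx_inferI[OF _ ok]; simp only: G_def typecheck cong: weak_congs)+
  have "Plus (Var 5) (Var 4) # G \<turnstile> PlusInd (Var 5) (Var 4) (Var 3) (Var 0) \<^bold>: Var 4"
    by (rule check_sound[OF _ ok'(1), of 100]) (simp only: G_def typecheck cong: weak_congs)
  from beta[OF this check_sound[OF s ok]]
  have 1: "G \<turnstile> App (Lam (Plus (Var 5) (Var 4)) (PlusInd (Var 5) (Var 4) (Var 3) (Var 0))) s
     \<doteq> PlusInd (Var 4) (Var 3) (Var 2) s \<^bold>: Var 3"
    by (simp only: typecheck ren_0 cong: weak_congs)
  \<comment> \<open>The motive and the branches are checked here once for both injections; the
    caller supplies only the computation rule.\<close>
  have 2: "G \<turnstile> PlusInd (Var 4) (Var 3) (Var 2) s \<doteq> Var m \<^bold>: Var 3"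
  proof (rule eq)
    show "Plus (Var 5) (Var 4) # G \<turnstile> Var 4 \<^bold>: Univ c"
      by (rule check_sound[OF _ ok'(1), of 100]) (simp only: G_def typecheck cong: weak_congs)
    show "Var 5 # G \<turnstile> Var 3 \<^bold>: Var 4"
      by (rule check_sound[OF _ ok'(2), of 100]) (simp only: G_def typecheck cong: weak_congs)
    show "Var 4 # G \<turnstile> Var 2 \<^bold>: Var 4"
      by (rule check_sound[OF _ ok'(3), of 100]) (simp only: G_def typecheck cong: weak_congs)
  qed
  have "G \<turnstile> Var 3 \<^bold>: Univ c"
    by (rule check_sound[OF _ ok, of 100]) (simp only: G_def typecheck cong: weak_congs)
  from t_rfl_conv[OF this check_sound[OF m ok] e_trans[OF 1 2]] show ?thesis .
qed

lemma case_inl_conv: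
  "[Var 4, Var 1, Var 0, Univ c, Univ b, Univ a] \<turnstile> Rfl (Var 2) \<^bold>: Eq (Var 3)
    (App (Lam (Plus (Var 5) (Var 4)) (PlusInd (Var 5) (Var 4) (Var 3) (Var 0))) (InL (Var 0))) (Var 2)"
  (is "?G \<turnstile> _ \<^bold>: _")
proof -
  have ok: "ok_ctx ?G"
    by (intro ok_ctx_inferI ok_ctx.simps(1)[THEN iffD2] TrueI; simp only: typecheck cong: weak_congs)
  have 0: "?G \<turnstile> Var 0 \<^bold>: Var 5"
    by (rule check_sound[OF _ ok, of 100]) (simp only: typecheck cong: weak_congs)
  show ?thesis
  proof (rule case_conv[OF ok])
    assume *: "Plus (Var 5) (Var 4) # ?G \<turnstile> Var 4 \<^bold>: Univ c" "Var 5 # ?G \<turnstile> Var 3 \<^bold>: Var 4"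
      "Var 4 # ?G \<turnstile> Var 2 \<^bold>: Var 4"
    show "?G \<turnstile> PlusInd (Var 4) (Var 3) (Var 2) (InL (Var 0)) \<doteq> Var 2 \<^bold>: Var 3"
      \<comment> \<open>Inside a branch one more variable is bound, so \<open>Var 3\<close> and
        \<open>Var 2\<close> stand for \<open>x\<close> and \<open>y\<close>.\<close>
      using plusind_inl[OF *(1) _ _ 0, of "Var 3" "Var 2"] *(2,3)
      by (simp only: typecheck cong: weak_congs)
  qed (simp_all only: typecheck cong: weak_congs)
qed

lemma case_inr_conv:
  "[Var 3, Var 1, Var 0, Univ c, Univ b, Univ a] \<turnstile> Rfl (Var 1) \<^bold>: Eq (Var 3)
    (App (Lam (Plus (Var 5) (Var 4)) (PlusInd (Var 5) (Var 4) (Var 3) (Var 0))) (InR (Var 0))) (Var 1)"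
  (is "?G \<turnstile> _ \<^bold>: _")
proof -
  have ok: "ok_ctx ?G"
    by (intro ok_ctx_inferI ok_ctx.simps(1)[THEN iffD2] TrueI; simp only: typecheck cong: weak_congs)
  have 0: "?G \<turnstile> Var 0 \<^bold>: Var 4"
    by (rule check_sound[OF _ ok, of 100]) (simp only: typecheck cong: weak_congs)
  show ?thesis
  proof (rule case_conv[OF ok])
    assume *: "Plus (Var 5) (Var 4) # ?G \<turnstile> Var 4 \<^bold>: Univ c" "Var 5 # ?G \<turnstile> Var 3 \<^bold>: Var 4"
      "Var 4 # ?G \<turnstile> Var 2 \<^bold>: Var 4"
    show "?G \<turnstile> PlusInd (Var 4) (Var 3) (Var 2) (InR (Var 0)) \<doteq> Var 1 \<^bold>: Var 3"
      using plusind_inr[OF *(1) _ _ 0, of "Var 3" "Var 2"] *(2,3)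
      by (simp only: typecheck cong: weak_congs)
  qed (simp_all only: typecheck cong: weak_congs)
qed

text \<open>Here \<open>X\<close>, \<open>T\<close>, \<open>x\<close>, \<open>y\<close> have the indices 3 down to 0.\<close>

lemma beta_rel_conv:
  "[Var 2, Var 1, Pi (Var 0) (Univ i), Univ u] \<turnstile> Rfl (Pi (App (Var 2) (Var 1)) (App (Var 3) (Var 1))) \<^bold>:
    Eq (Univ i) (App (App (Lam (Var 3) (Lam (Var 4) (Pi (App (Var 4) (Var 1)) (App (Var 5) (Var 1)))))
      (Var 1)) (Var 0)) (Pi (App (Var 2) (Var 1)) (App (Var 3) (Var 1)))"
  (is "?G \<turnstile> Rfl ?r \<^bold>: Eq _ (App (App (Lam _ ?b) _) _) _")
proof -
  have ok: "ok_ctx ?G"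
    by (intro ok_ctx_inferI ok_ctx.simps(1)[THEN iffD2] TrueI; simp only: typecheck cong: weak_congs)
  have ok': "ok_ctx (Var 3 # ?G)" "ok_ctx (Pi (Var 3) (Univ i) # ?G)"
    by (rule ok_ctx_inferI[OF _ ok]; simp only: typecheck cong: weak_congs)+
  let ?b' = "Pi (App (Var 3) (Var 2)) (App (Var 4) (Var 1))"
  have b: "Var 3 # ?G \<turnstile> ?b \<^bold>: Pi (Var 4) (Univ i)"
    and b': "Var 3 # ?G \<turnstile> ?b' \<^bold>: Univ i"
    by (rule check_sound[OF _ ok'(1), of 100]; simp only: typecheck cong: weak_congs)+
  have x: "?G \<turnstile> Var 1 \<^bold>: Var 3" and y: "?G \<turnstile> Var 0 \<^bold>: Var 3"
    and r: "?G \<turnstile> ?r \<^bold>: Univ i" and U: "?G \<turnstile> Univ i \<^bold>: Univ (Suc i)"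
    by (rule check_sound[OF _ ok, of 100]; simp only: typecheck cong: weak_congs)+
  \<comment> \<open>\<open>App\<close> has no primitive congruence rule. The inner beta step is
    carried under the outer application by substituting both of its sides for the function variable
    of this term.\<close>
  have f: "Pi (Var 3) (Univ i) # ?G \<turnstile> App (Var 0) (Var 1) \<^bold>: Univ i"
    by (rule check_sound[OF _ ok'(2), of 100]) (simp only: typecheck cong: weak_congs)
  have "?G \<turnstile> App (Lam (Var 3) ?b) (Var 1) \<doteq> Lam (Var 3) ?b' \<^bold>: Pi (Var 3) (Univ i)"
    using beta[OF b x] by (simp only: typecheck cong: weak_congs)
  from e_subst[OF e_refl[OF f] this]
  have 1: "?G \<turnstile> App (App (Lam (Var 3) ?b) (Var 1)) (Var 0) \<doteq> App (Lam (Var 3) ?b') (Var 0) \<^bold>: Univ i"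
    by (simp only: typecheck cong: weak_congs)
  have 2: "?G \<turnstile> App (Lam (Var 3) ?b') (Var 0) \<doteq> ?r \<^bold>: Univ i"
    using beta[OF b' y] by (simp only: typecheck cong: weak_congs)
  show ?thesis
    using t_rfl_conv[OF U r e_trans[OF 1 2]] .
qed


section \<open>Propositions\<close>

abbreviation neg_prop :: "nat \<Rightarrow> expr" where
  "neg_prop i \<equiv> PI (TYPE_OF i) (\<lambda>A. is_proposition (NEG A))"

text \<open>Functions into an empty type agree pointwise, since any argument yields a
  contradiction.\<close>

lemma neg_prop: "provable (neg_prop i)"
  apply (rule provableI[where e = "LM (TYPE_OF i) (\<lambda>A. LM (NEG A) (\<lambda>f. LM (NEG A) (\<lambda>g.
     FUNEXT f g (LM A (\<lambda>a. EXFALSO (ID (ZERO 0) (f \<cdot> a) (g \<cdot> a)) (f \<cdot> a))))))"])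
  by (simp only: typecheck cong: weak_congs)

abbreviation sum_prop :: "nat \<Rightarrow> expr" where
  "sum_prop i \<equiv> PI (TYPE_OF i) (\<lambda>A. PI (TYPE_OF i) (\<lambda>B. is_proposition A \<Rrightarrow> is_proposition B \<Rrightarrow>
     (A \<Rrightarrow> NEG B) \<Rrightarrow> is_proposition (A \<oplus> B)))"

text \<open>Equal injections are joined along the path given by propositionality of the summand;
  different ones contradict the exclusion \<open>n\<close>.\<close>

lemma sum_prop: "provable (sum_prop i)"
  apply (rule provableI[where e = "LM (TYPE_OF i) (\<lambda>A. LM (TYPE_OF i) (\<lambda>B.
     LM (is_proposition A) (\<lambda>hA. LM (is_proposition B) (\<lambda>hB. LM (A \<Rrightarrow> NEG B) (\<lambda>n.
     LM (A \<oplus> B) (\<lambda>s. LM (A \<oplus> B) (\<lambda>s'. PLUSIND (\<lambda>z. ID (A \<oplus> B) z s')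
       (\<lambda>a. PLUSIND (\<lambda>z. ID (A \<oplus> B) (INL a) z)
          (\<lambda>a'. PATHIND (\<lambda>z. ID (A \<oplus> B) (INL a) (INL z)) (RFL (INL a)) a' (hA \<cdot> a \<cdot> a'))
          (\<lambda>b. EXFALSO (ID (A \<oplus> B) (INL a) (INR b)) (n \<cdot> a \<cdot> b)) s')
       (\<lambda>b. PLUSIND (\<lambda>z. ID (A \<oplus> B) (INR b) z)
          (\<lambda>a. EXFALSO (ID (A \<oplus> B) (INR b) (INL a)) (n \<cdot> a \<cdot> b))
          (\<lambda>b'. PATHIND (\<lambda>z. ID (A \<oplus> B) (INR b) (INR z)) (RFL (INR b)) b' (hB \<cdot> b \<cdot> b')) s')
       s)))))))"])
  by (simp only: typecheck cong: weak_congs)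

text \<open>\<open>NEG P\<close> and \<open>NEG (NEG P)\<close> exclude each other, so their sum is
  a proposition, and extensionality in both arguments does the rest. This permits eliminating
  truncations into weak excluded middle.\<close>

lemma wem_prop: "provable (is_proposition (weak_excluded_middle v))"
  apply (rule provable_mp[OF neg_prop[of v]])
   apply (simp only: typecheck cong: weak_congs)
  apply (rule provable_mp[OF sum_prop[of v]])
   apply (simp only: typecheck cong: weak_congs)
  apply (rule provableI[where e = "LM (sum_prop v) (\<lambda>sp. LM (neg_prop v) (\<lambda>np.
     LM (weak_excluded_middle v) (\<lambda>e. LM (weak_excluded_middle v) (\<lambda>e'.
       FUNEXT e e' (LM (TYPE_OF v) (\<lambda>P. FUNEXT (e \<cdot> P) (e' \<cdot> P) (LM (is_proposition P) (\<lambda>h.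
         sp \<cdot> (NEG P) \<cdot> (NEG (NEG P)) \<cdot> (np \<cdot> P) \<cdot> (np \<cdot> (NEG P)) \<cdot>
           (LM (NEG P) (\<lambda>n. LM (NEG (NEG P)) (\<lambda>m. m \<cdot> n))) \<cdot> (e \<cdot> P \<cdot> h) \<cdot> (e' \<cdot> P \<cdot> h)))))))))"])
  by (simp only: typecheck cong: weak_congs)

lemma em_prop: "provable (is_proposition (excluded_middle v))"
  apply (rule provable_mp[OF neg_prop[of v]], simp only: typecheck cong: weak_congs)
  apply (rule provable_mp[OF sum_prop[of v]], simp only: typecheck cong: weak_congs)
  apply (rule provableI[where e = "LM (sum_prop v) (\<lambda>sp. LM (neg_prop v) (\<lambda>np.
     LM (excluded_middle v) (\<lambda>e. LM (excluded_middle v) (\<lambda>e'.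
       FUNEXT e e' (LM (TYPE_OF v) (\<lambda>P. FUNEXT (e \<cdot> P) (e' \<cdot> P) (LM (is_proposition P) (\<lambda>h.
         sp \<cdot> P \<cdot> (NEG P) \<cdot> h \<cdot> (np \<cdot> P) \<cdot>
           (LM P (\<lambda>p. LM (NEG P) (\<lambda>n. n \<cdot> p))) \<cdot> (e \<cdot> P \<cdot> h) \<cdot> (e' \<cdot> P \<cdot> h)))))))))"])
  by (simp only: typecheck cong: weak_congs)


section \<open>Suprema of the families delta\<close>

abbreviation case_inl :: "nat \<Rightarrow> nat \<Rightarrow> nat \<Rightarrow> expr" where
  "case_inl a b c \<equiv> PI (TYPE_OF a) (\<lambda>A. PI (TYPE_OF b) (\<lambda>B. PI (TYPE_OF c) (\<lambda>C.
     PI C (\<lambda>x. PI C (\<lambda>y. PI A (\<lambda>i. ID C (LM (A \<oplus> B) (\<lambda>s. CASE C x y s) \<cdot> INL i) x))))))"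

abbreviation case_inr :: "nat \<Rightarrow> nat \<Rightarrow> nat \<Rightarrow> expr" where
  "case_inr a b c \<equiv> PI (TYPE_OF a) (\<lambda>A. PI (TYPE_OF b) (\<lambda>B. PI (TYPE_OF c) (\<lambda>C.
     PI C (\<lambda>x. PI C (\<lambda>y. PI B (\<lambda>i. ID C (LM (A \<oplus> B) (\<lambda>s. CASE C x y s) \<cdot> INR i) y))))))"

abbreviation rel_on :: "nat \<Rightarrow> expr \<Rightarrow> expr" where
  "rel_on t X \<equiv> X \<Rrightarrow> X \<Rrightarrow> TYPE_OF t"

abbreviation is_ub :: "nat \<Rightarrow> expr \<Rightarrow> expr \<Rightarrow> expr \<Rightarrow> expr \<Rightarrow> expr \<Rightarrow> expr \<Rightarrow> expr" where
  "is_ub v X R x y P w \<equiv> PI (ONE v \<oplus> P) (\<lambda>i. R \<cdot> (delta v X x y P \<cdot> i) \<cdot> w)"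

abbreviation ub_in :: "nat \<Rightarrow> nat \<Rightarrow> nat \<Rightarrow> expr" where
  "ub_in u t v \<equiv> PI (TYPE_OF u) (\<lambda>X. PI (rel_on t X) (\<lambda>R. PI X (\<lambda>x. PI X (\<lambda>y. PI (TYPE_OF v) (\<lambda>P.
     PI X (\<lambda>w. R \<cdot> x \<cdot> w \<Rrightarrow> (P \<Rrightarrow> R \<cdot> y \<cdot> w) \<Rrightarrow> is_ub v X R x y P w))))))"

abbreviation ub_fst :: "nat \<Rightarrow> nat \<Rightarrow> nat \<Rightarrow> expr" where
  "ub_fst u t v \<equiv> PI (TYPE_OF u) (\<lambda>X. PI (rel_on t X) (\<lambda>R. PI X (\<lambda>x. PI X (\<lambda>y. PI (TYPE_OF v) (\<lambda>P.
     PI X (\<lambda>w. is_ub v X R x y P w \<Rrightarrow> R \<cdot> x \<cdot> w))))))"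

abbreviation ub_snd :: "nat \<Rightarrow> nat \<Rightarrow> nat \<Rightarrow> expr" where
  "ub_snd u t v \<equiv> PI (TYPE_OF u) (\<lambda>X. PI (rel_on t X) (\<lambda>R. PI X (\<lambda>x. PI X (\<lambda>y. PI (TYPE_OF v) (\<lambda>P.
     PI X (\<lambda>w. is_ub v X R x y P w \<Rrightarrow> P \<Rrightarrow> R \<cdot> y \<cdot> w))))))"

text \<open>The checker cannot see this equation, so the derivation is built directly:
  \<open>t_lam\<close> creates the abstractions, and the body is the reflexivity of
  \<open>case_inl_conv\<close>.\<close>

lemma case_inl: "provable (case_inl a b c)"
  unfolding provable_def
  by (rule exI, simp only: typecheck, (rule t_lam)+)
    (rule case_inl_conv[simplified typecheck])
lemma case_inr: "provable (case_inr a b c)"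
  unfolding provable_def
  by (rule exI, simp only: typecheck, (rule t_lam)+)
    (rule case_inr_conv[simplified typecheck])

text \<open>Together with \<open>ub_fst\<close> and \<open>ub_snd\<close> this describes the upper
  bounds of the family by two conditions, so that later terms never evaluate the family.\<close>

lemma ub_in: "provable (ub_in u t v)"
  apply (rule provable_mp[OF case_inl[of v v u]], simp only: typecheck cong: weak_congs)
  apply (rule provable_mp[OF case_inr[of v v u]], simp only: typecheck cong: weak_congs)
  \<comment> \<open>The paths lead from a value of the family to \<open>x\<close> or
    \<open>y\<close>. Transport against that direction takes as motive the functions into the fixed
    target, starting from the identity.\<close>
  apply (rule provableI[where e = "LM (case_inr v v u) (\<lambda>cr. LM (case_inl v v u) (\<lambda>cl.
     LM (TYPE_OF u) (\<lambda>X. LM (rel_on t X) (\<lambda>R. LM X (\<lambda>x. LM X (\<lambda>y. LM (TYPE_OF v) (\<lambda>P. LM X (\<lambda>w.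
     LM (R \<cdot> x \<cdot> w) (\<lambda>r. LM (P \<Rrightarrow> R \<cdot> y \<cdot> w) (\<lambda>f. LM (ONE v \<oplus> P) (\<lambda>i.
       PLUSIND (\<lambda>i. R \<cdot> (delta v X x y P \<cdot> i) \<cdot> w)
         (\<lambda>j. PATHIND (\<lambda>z. R \<cdot> z \<cdot> w \<Rrightarrow> R \<cdot> (delta v X x y P \<cdot> INL j) \<cdot> w)
           (LM (R \<cdot> (delta v X x y P \<cdot> INL j) \<cdot> w) (\<lambda>q. q)) x
           (cl \<cdot> ONE v \<cdot> P \<cdot> X \<cdot> x \<cdot> y \<cdot> j) \<cdot> r)
         (\<lambda>p. PATHIND (\<lambda>z. R \<cdot> z \<cdot> w \<Rrightarrow> R \<cdot> (delta v X x y P \<cdot> INR p) \<cdot> w)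
           (LM (R \<cdot> (delta v X x y P \<cdot> INR p) \<cdot> w) (\<lambda>q. q)) y
           (cr \<cdot> ONE v \<cdot> P \<cdot> X \<cdot> x \<cdot> y \<cdot> p) \<cdot> (f \<cdot> p)) i)))))))))))"])
  by (simp only: typecheck cong: weak_congs)

lemma ub_fst: "provable (ub_fst u t v)"
  apply (rule provable_mp[OF case_inl[of v v u]], simp only: typecheck cong: weak_congs)
  apply (rule provableI[where e = "LM (case_inl v v u) (\<lambda>cl.
     LM (TYPE_OF u) (\<lambda>X. LM (rel_on t X) (\<lambda>R. LM X (\<lambda>x. LM X (\<lambda>y. LM (TYPE_OF v) (\<lambda>P. LM X (\<lambda>w.
     LM (is_ub v X R x y P w) (\<lambda>f. PATHIND (\<lambda>z. R \<cdot> z \<cdot> w) (f \<cdot> INL (STAR v)) x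
       (cl \<cdot> ONE v \<cdot> P \<cdot> X \<cdot> x \<cdot> y \<cdot> STAR v)))))))))"])
  by (simp only: typecheck cong: weak_congs)

lemma ub_snd: "provable (ub_snd u t v)"
  apply (rule provable_mp[OF case_inr[of v v u]], simp only: typecheck cong: weak_congs)
  apply (rule provableI[where e = "LM (case_inr v v u) (\<lambda>cr.
     LM (TYPE_OF u) (\<lambda>X. LM (rel_on t X) (\<lambda>R. LM X (\<lambda>x. LM X (\<lambda>y. LM (TYPE_OF v) (\<lambda>P. LM X (\<lambda>w.
     LM (is_ub v X R x y P w) (\<lambda>f. LM P (\<lambda>p. PATHIND (\<lambda>z. R \<cdot> z \<cdot> w) (f \<cdot> INR p) y
       (cr \<cdot> ONE v \<cdot> P \<cdot> X \<cdot> x \<cdot> y \<cdot> p))))))))))"])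
  by (simp only: typecheck cong: weak_congs)


section \<open>Decidable equality implies excluded middle\<close>

abbreviation nontrivial_wem :: "nat \<Rightarrow> nat \<Rightarrow> nat \<Rightarrow> expr" where
  "nontrivial_wem u t v \<equiv> PI (TYPE_OF u) (\<lambda>X. PI (rel_on t X) (\<lambda>R. reflexive X R \<Rrightarrow>
     antisymmetric X R \<Rrightarrow> delta_complete v X R \<Rrightarrow> decidable_equality X \<Rrightarrow>
     PI X (\<lambda>x. PI X (\<lambda>y. R \<cdot> x \<cdot> y \<otimes> NEG (ID X x y) \<Rrightarrow> weak_excluded_middle v))))"

abbreviation (input) SUP_UB :: "expr \<Rightarrow> expr" where
  "SUP_UB q \<equiv> FST (SND q)"

abbreviation (input) SUP_LEAST :: "expr \<Rightarrow> expr" where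
  "SUP_LEAST q \<equiv> SND (SND q)"

text \<open>If \<open>s\<close> equals \<open>x\<close>, a proof of \<open>P\<close> puts
  \<open>y\<close> below \<open>s\<close>, hence below \<open>x\<close>, and antisymmetry gives the
  excluded equation. If not, a refutation of \<open>P\<close> makes \<open>x\<close> an upper bound,
  which forces \<open>s\<close> to equal \<open>x\<close>.\<close>

lemma nontrivial_wem: "provable (nontrivial_wem u t v)"
  apply (rule provable_mp[OF ub_in[of u t v]], simp only: typecheck cong: weak_congs)
  apply (rule provable_mp[OF ub_fst[of u t v]], simp only: typecheck cong: weak_congs)
  apply (rule provable_mp[OF ub_snd[of u t v]], simp only: typecheck cong: weak_congs)
  apply (rule provableI[where e = "LM (ub_snd u t v) (\<lambda>us. LM (ub_fst u t v) (\<lambda>uf.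
     LM (ub_in u t v) (\<lambda>ui. LM (TYPE_OF u) (\<lambda>X. LM (rel_on t X) (\<lambda>R. LM (reflexive X R) (\<lambda>re.
     LM (antisymmetric X R) (\<lambda>an. LM (delta_complete v X R) (\<lambda>c. LM (decidable_equality X) (\<lambda>de.
     LM X (\<lambda>x. LM X (\<lambda>y. LM (R \<cdot> x \<cdot> y \<otimes> NEG (ID X x y)) (\<lambda>ln.
     LM (TYPE_OF v) (\<lambda>P. LM (is_proposition P) (\<lambda>h.
     let l = FST ln; q = c \<cdot> x \<cdot> y \<cdot> l \<cdot> P \<cdot> h; s = FST q
     in PLUSIND (\<lambda>_. NEG P \<oplus> NEG (NEG P))
       (\<lambda>e. INL (LM P (\<lambda>p. SND ln \<cdot> (an \<cdot> x \<cdot> y \<cdot> l \<cdot>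
          (PATHIND (\<lambda>z. R \<cdot> y \<cdot> z) (us \<cdot> X \<cdot> R \<cdot> x \<cdot> y \<cdot> P \<cdot> s \<cdot> SUP_UB q \<cdot> p) x e)))))
       (\<lambda>k. INR (LM (NEG P) (\<lambda>n. k \<cdot> (an \<cdot> s \<cdot> x \<cdot>
          (SUP_LEAST q \<cdot> x \<cdot> (ui \<cdot> X \<cdot> R \<cdot> x \<cdot> y \<cdot> P \<cdot> x \<cdot> (re \<cdot> x) \<cdot>
             (LM P (\<lambda>p. EXFALSO (R \<cdot> y \<cdot> x) (n \<cdot> p))))) \<cdot>
          (uf \<cdot> X \<cdot> R \<cdot> x \<cdot> y \<cdot> P \<cdot> s \<cdot> SUP_UB q)))))
       (de \<cdot> s \<cdot> x)))))))))))))))"])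
  by (simp only: Let_def typecheck cong: weak_congs)

abbreviation positive_em :: "nat \<Rightarrow> nat \<Rightarrow> nat \<Rightarrow> expr" where
  "positive_em u t v \<equiv> PI (TYPE_OF u) (\<lambda>X. PI (rel_on t X) (\<lambda>R. reflexive X R \<Rrightarrow>
     PI (transitive X R) (\<lambda>tr. antisymmetric X R \<Rrightarrow> PI (delta_complete v X R) (\<lambda>c.
     decidable_equality X \<Rrightarrow>
     PI X (\<lambda>x. PI X (\<lambda>y. strictly_below v X R tr c x y \<Rrightarrow> excluded_middle v))))))"

text \<open>If \<open>y\<close> equals \<open>s\<close>, strictness yields \<open>P\<close> at once.
  Otherwise \<open>P\<close> is refuted: it would put \<open>y\<close> below \<open>s\<close>, while
  \<open>s\<close> is below the upper bound \<open>y\<close>.\<close>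

lemma positive_em: "provable (positive_em u t v)"
  apply (rule provable_mp[OF ub_in[of u t v]], simp only: typecheck cong: weak_congs)
  apply (rule provable_mp[OF ub_snd[of u t v]], simp only: typecheck cong: weak_congs)
  \<comment> \<open>\<open>l\<close> takes the detour through transitivity because
    \<open>strictly_below\<close>, used with \<open>y\<close> for \<open>z\<close>, speaks of the
    supremum formed with exactly that proof, and types are compared syntactically.\<close>
  apply (rule provableI[where e = "LM (ub_snd u t v) (\<lambda>us.
     LM (ub_in u t v) (\<lambda>ui. LM (TYPE_OF u) (\<lambda>X. LM (rel_on t X) (\<lambda>R. LM (reflexive X R) (\<lambda>re.
     LM (transitive X R) (\<lambda>tr. LM (antisymmetric X R) (\<lambda>an. LM (delta_complete v X R) (\<lambda>c.
     LM (decidable_equality X) (\<lambda>de. LM X (\<lambda>x. LM X (\<lambda>y. LM (strictly_below v X R tr c x y) (\<lambda>sb.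
     LM (TYPE_OF v) (\<lambda>P. LM (is_proposition P) (\<lambda>h.
     let l = tr \<cdot> x \<cdot> y \<cdot> y \<cdot> FST sb \<cdot> (re \<cdot> y); q = c \<cdot> x \<cdot> y \<cdot> l \<cdot> P \<cdot> h; s = FST q
     in PLUSIND (\<lambda>_. P \<oplus> NEG P)
       (\<lambda>e. INL (SND sb \<cdot> y \<cdot> (re \<cdot> y) \<cdot> P \<cdot> h \<cdot> e))
       (\<lambda>k. INR (LM P (\<lambda>p. k \<cdot> (an \<cdot> y \<cdot> s \<cdot>
          (us \<cdot> X \<cdot> R \<cdot> x \<cdot> y \<cdot> P \<cdot> s \<cdot> SUP_UB q \<cdot> p) \<cdot>
          (SUP_LEAST q \<cdot> y \<cdot> (ui \<cdot> X \<cdot> R \<cdot> x \<cdot> y \<cdot> P \<cdot> y \<cdot> l \<cdot> (LM P (\<lambda>_. re \<cdot> y))))))))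
       (de \<cdot> y \<cdot> s)))))))))))))))"])
  by (simp only: Let_def typecheck cong: weak_congs)

abbreviation poset_structure ::
  "nat \<Rightarrow> nat \<Rightarrow> (expr \<Rightarrow> expr \<Rightarrow> expr \<Rightarrow> expr \<Rightarrow> expr) \<Rightarrow> expr \<Rightarrow> expr \<Rightarrow> expr" where
  "poset_structure t v Q X R \<equiv> prop_valued X R \<otimes> reflexive X R \<otimes>
     SG (transitive X R) (\<lambda>tr. antisymmetric X R \<otimes> SG (delta_complete v X R) (\<lambda>c.
       locally_small v X R \<otimes> decidable_equality X \<otimes> Q X R tr c))"

abbreviation SPLIT_POSET ::
  "expr \<Rightarrow> expr \<Rightarrow> (expr \<Rightarrow> expr \<Rightarrow> expr \<Rightarrow> expr \<Rightarrow> expr \<Rightarrow> expr \<Rightarrow> expr \<Rightarrow> expr \<Rightarrow> expr) \<Rightarrow> expr" where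
  "SPLIT_POSET C S k \<equiv> SPLIT C S (\<lambda>X S. SPLIT C S (\<lambda>R S. SPLIT C S (\<lambda>_ S. SPLIT C S (\<lambda>re S.
     SPLIT C S (\<lambda>tr S. SPLIT C S (\<lambda>an S. SPLIT C S (\<lambda>c S. SPLIT C S (\<lambda>_ S.
     SPLIT C S (\<lambda>de q. k X R re tr an c de q)))))))))"

text \<open>The poset, \<open>x\<close> and \<open>y\<close> are each hidden under a truncation; all
  three are eliminated into a proposition by \<open>wem_prop\<close>.\<close>

lemma exists_nontrivial_imp_wem:
  "provable (exists_poset u t v (\<lambda>X R tr c. nontrivial X R) \<Rrightarrow> weak_excluded_middle v)"
  apply (rule provable_mp[OF wem_prop[of v]], simp only: typecheck cong: weak_congs)
  apply (rule provable_mp[OF nontrivial_wem[of u t v]], simp only: typecheck cong: weak_congs)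
  apply (rule provableI[where e = "LM (nontrivial_wem u t v) (\<lambda>nw.
     LM (is_proposition (weak_excluded_middle v)) (\<lambda>wp.
     LM (exists_poset u t v (\<lambda>X R tr c. nontrivial X R)) (\<lambda>S. let W = weak_excluded_middle v in
     TRREC W wp
       (SG (TYPE_OF u) (\<lambda>X. SG (rel_on t X) (poset_structure t v (\<lambda>X R tr c. nontrivial X R) X))) S
       (\<lambda>S. SPLIT_POSET W S (\<lambda>X R re tr an c de q.
       TRREC W wp (SG X (\<lambda>x. EXISTS X (\<lambda>y. R \<cdot> x \<cdot> y \<otimes> NEG (ID X x y)))) q
         (\<lambda>q. SPLIT W q (\<lambda>x q. TRREC W wp (SG X (\<lambda>y. R \<cdot> x \<cdot> y \<otimes> NEG (ID X x y))) q
         (\<lambda>q. SPLIT W q (\<lambda>y q. nw \<cdot> X \<cdot> R \<cdot> re \<cdot> an \<cdot> c \<cdot> de \<cdot> x \<cdot> y \<cdot> q)))))))))"])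
  by (simp only: Let_def typecheck cong: weak_congs)

lemma exists_positive_imp_em:
  "provable (exists_poset u t v (\<lambda>X R tr c. positive v X R tr c) \<Rrightarrow> excluded_middle v)"
  apply (rule provable_mp[OF em_prop[of v]], simp only: typecheck cong: weak_congs)
  apply (rule provable_mp[OF positive_em[of u t v]], simp only: typecheck cong: weak_congs)
  apply (rule provableI[where e = "LM (positive_em u t v) (\<lambda>pe.
     LM (is_proposition (excluded_middle v)) (\<lambda>ep.
     LM (exists_poset u t v (\<lambda>X R tr c. positive v X R tr c)) (\<lambda>S. let E = excluded_middle v in
     TRREC E ep
       (SG (TYPE_OF u) (\<lambda>X. SG (rel_on t X) (poset_structure t v (\<lambda>X R tr c. positive v X R tr c) X))) S
       (\<lambda>S. SPLIT_POSET E S (\<lambda>X R re tr an c de q.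
       TRREC E ep (SG X (\<lambda>x. EXISTS X (\<lambda>y. strictly_below v X R tr c x y))) q
         (\<lambda>q. SPLIT E q (\<lambda>x q. TRREC E ep (SG X (\<lambda>y. strictly_below v X R tr c x y)) q
         (\<lambda>q. SPLIT E q (\<lambda>y q. pe \<cdot> X \<cdot> R \<cdot> re \<cdot> tr \<cdot> an \<cdot> c \<cdot> de \<cdot> x \<cdot> y \<cdot> q)))))))))"])
  by (simp only: Let_def typecheck cong: weak_congs)


section \<open>Excluded middle implies completeness of decidable orders\<close>

abbreviation decidable_rel :: "expr \<Rightarrow> expr \<Rightarrow> expr" where
  "decidable_rel X R \<equiv> PI X (\<lambda>x. PI X (\<lambda>y. R \<cdot> x \<cdot> y \<oplus> NEG (R \<cdot> x \<cdot> y)))"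

abbreviation wem_complete :: "nat \<Rightarrow> nat \<Rightarrow> nat \<Rightarrow> expr" where
  "wem_complete u t v \<equiv> weak_excluded_middle v \<Rrightarrow> PI (TYPE_OF u) (\<lambda>X. PI (rel_on t X) (\<lambda>R.
     reflexive X R \<Rrightarrow> decidable_rel X R \<Rrightarrow> delta_complete v X R))"

text \<open>Under \<open>NEG P\<close> the supremum is \<open>x\<close>. Under
  \<open>NEG (NEG P)\<close> it is \<open>y\<close>: if \<open>y\<close> were not below an upper
  bound \<open>w\<close>, then \<open>P\<close> would fail, and decidability of the order turns this
  double negation into \<open>y\<close> below \<open>w\<close>.\<close>

lemma wem_complete: "provable (wem_complete u t v)"
  apply (rule provable_mp[OF ub_in[of u t v]], simp only: typecheck cong: weak_congs)
  apply (rule provable_mp[OF ub_fst[of u t v]], simp only: typecheck cong: weak_congs)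
  apply (rule provable_mp[OF ub_snd[of u t v]], simp only: typecheck cong: weak_congs)
  apply (rule provableI[where e = "LM (ub_snd u t v) (\<lambda>us. LM (ub_fst u t v) (\<lambda>uf.
     LM (ub_in u t v) (\<lambda>ui. LM (weak_excluded_middle v) (\<lambda>wem.
     LM (TYPE_OF u) (\<lambda>X. LM (rel_on t X) (\<lambda>R. LM (reflexive X R) (\<lambda>re. LM (decidable_rel X R) (\<lambda>dec.
     LM X (\<lambda>x. LM X (\<lambda>y. LM (R \<cdot> x \<cdot> y) (\<lambda>l. LM (TYPE_OF v) (\<lambda>P. LM (is_proposition P) (\<lambda>h.
     PLUSIND (\<lambda>_. SG X (\<lambda>s. is_sup X R (ONE v \<oplus> P) (delta v X x y P) s))
       (\<lambda>n. PAIR x (PAIR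
          (ui \<cdot> X \<cdot> R \<cdot> x \<cdot> y \<cdot> P \<cdot> x \<cdot> (re \<cdot> x) \<cdot> (LM P (\<lambda>p. EXFALSO (R \<cdot> y \<cdot> x) (n \<cdot> p))))
          (LM X (\<lambda>w. LM (is_ub v X R x y P w) (\<lambda>f. uf \<cdot> X \<cdot> R \<cdot> x \<cdot> y \<cdot> P \<cdot> w \<cdot> f)))))
       (\<lambda>nn. PAIR y (PAIR
          (ui \<cdot> X \<cdot> R \<cdot> x \<cdot> y \<cdot> P \<cdot> y \<cdot> l \<cdot> (LM P (\<lambda>_. re \<cdot> y)))
          (LM X (\<lambda>w. LM (is_ub v X R x y P w) (\<lambda>f. PLUSIND (\<lambda>_. R \<cdot> y \<cdot> w) (\<lambda>r. r)
             (\<lambda>nr. EXFALSO (R \<cdot> y \<cdot> w) (nn \<cdot> (LM P (\<lambda>p. nr \<cdot> (us \<cdot> X \<cdot> R \<cdot> x \<cdot> y \<cdot> P \<cdot> w \<cdot> f \<cdot> p)))))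
             (dec \<cdot> y \<cdot> w))))))
       (wem \<cdot> P \<cdot> h))))))))))))))"])
  by (simp only: Let_def typecheck cong: weak_congs)

abbreviation em_positive :: "nat \<Rightarrow> nat \<Rightarrow> nat \<Rightarrow> expr" where
  "em_positive u t v \<equiv> excluded_middle v \<Rrightarrow> PI (TYPE_OF u) (\<lambda>X. PI (rel_on t X) (\<lambda>R.
     reflexive X R \<Rrightarrow> PI (transitive X R) (\<lambda>tr. PI (delta_complete v X R) (\<lambda>c.
     PI X (\<lambda>x. PI X (\<lambda>y. R \<cdot> x \<cdot> y \<Rrightarrow> NEG (R \<cdot> y \<cdot> x) \<Rrightarrow> positive v X R tr c))))))"

text \<open>Let \<open>z\<close> be the supremum of the family for \<open>x\<close>,
  \<open>z\<close> and \<open>P\<close>. If \<open>P\<close> failed, \<open>x\<close> would be an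
  upper bound, so \<open>z\<close>, and with it \<open>y\<close>, would be below \<open>x\<close>,
  contradicting \<open>k\<close>. Excluded middle then gives \<open>P\<close>.\<close>

lemma em_positive: "provable (em_positive u t v)"
  apply (rule provable_mp[OF ub_in[of u t v]], simp only: typecheck cong: weak_congs)
  apply (rule provableI[where e = "
     LM (ub_in u t v) (\<lambda>ui. LM (excluded_middle v) (\<lambda>em.
     LM (TYPE_OF u) (\<lambda>X. LM (rel_on t X) (\<lambda>R. LM (reflexive X R) (\<lambda>re. LM (transitive X R) (\<lambda>tr.
     LM (delta_complete v X R) (\<lambda>c. LM X (\<lambda>x. LM X (\<lambda>y. LM (R \<cdot> x \<cdot> y) (\<lambda>l. LM (NEG (R \<cdot> y \<cdot> x)) (\<lambda>k.
     TRIN (PAIR x (TRIN (PAIR y (PAIR l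
       (LM X (\<lambda>z. LM (R \<cdot> y \<cdot> z) (\<lambda>m. LM (TYPE_OF v) (\<lambda>P. LM (is_proposition P) (\<lambda>h.
        let q = c \<cdot> x \<cdot> z \<cdot> (tr \<cdot> x \<cdot> y \<cdot> z \<cdot> l \<cdot> m) \<cdot> P \<cdot> h; s = FST q
        in LM (ID X z s) (\<lambda>e. PLUSIND (\<lambda>_. P) (\<lambda>p. p)
          (\<lambda>n. EXFALSO P (k \<cdot> (tr \<cdot> y \<cdot> z \<cdot> x \<cdot> m \<cdot>
             (PATHIND (\<lambda>z'. R \<cdot> z' \<cdot> x \<Rrightarrow> R \<cdot> z \<cdot> x) (LM (R \<cdot> z \<cdot> x) (\<lambda>r. r)) s e \<cdot>
               (SUP_LEAST q \<cdot> x \<cdot> (ui \<cdot> X \<cdot> R \<cdot> x \<cdot> z \<cdot> P \<cdot> x \<cdot> (re \<cdot> x) \<cdot>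
                 (LM P (\<lambda>p. EXFALSO (R \<cdot> z \<cdot> x) (n \<cdot> p)))))))))
          (em \<cdot> P \<cdot> h))))))))))))))))))))))"])
  by (simp only: Let_def typecheck cong: weak_congs)

abbreviation em_wem :: "nat \<Rightarrow> expr" where
  "em_wem v \<equiv> excluded_middle v \<Rrightarrow> weak_excluded_middle v"

lemma em_wem: "provable (em_wem v)"
  apply (rule provableI[where e = "LM (excluded_middle v) (\<lambda>em. LM (TYPE_OF v) (\<lambda>P.
     LM (is_proposition P) (\<lambda>h. PLUSIND (\<lambda>_. NEG P \<oplus> NEG (NEG P))
       (\<lambda>p. INR (LM (NEG P) (\<lambda>n. n \<cdot> p))) (\<lambda>n. INL n) (em \<cdot> P \<cdot> h))))"])
  by (simp only: typecheck cong: weak_congs)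

abbreviation rel_dec_eq :: "nat \<Rightarrow> nat \<Rightarrow> expr" where
  "rel_dec_eq u t \<equiv> PI (TYPE_OF u) (\<lambda>X. PI (rel_on t X) (\<lambda>R.
     reflexive X R \<Rrightarrow> antisymmetric X R \<Rrightarrow> decidable_rel X R \<Rrightarrow> decidable_equality X))"

text \<open>Antisymmetry reduces equality to two inequalities, and reflexivity transported along an
  equation gives both.\<close>

lemma rel_dec_eq: "provable (rel_dec_eq u t)"
  apply (rule provableI[where e = "LM (TYPE_OF u) (\<lambda>X. LM (rel_on t X) (\<lambda>R. LM (reflexive X R) (\<lambda>re.
     LM (antisymmetric X R) (\<lambda>an. LM (decidable_rel X R) (\<lambda>dec. LM X (\<lambda>x. LM X (\<lambda>y.
     PLUSIND (\<lambda>_. ID X x y \<oplus> NEG (ID X x y))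
       (\<lambda>r. PLUSIND (\<lambda>_. ID X x y \<oplus> NEG (ID X x y))
         (\<lambda>r'. INL (an \<cdot> x \<cdot> y \<cdot> r \<cdot> r'))
         (\<lambda>n. INR (LM (ID X x y) (\<lambda>e. n \<cdot> PATHIND (\<lambda>z. R \<cdot> z \<cdot> x) (re \<cdot> x) y e)))
         (dec \<cdot> y \<cdot> x))
       (\<lambda>n. INR (LM (ID X x y) (\<lambda>e. n \<cdot> PATHIND (\<lambda>z. R \<cdot> x \<cdot> z) (re \<cdot> x) y e)))
       (dec \<cdot> x \<cdot> y))))))))"])
  by (simp only: typecheck cong: weak_congs)


section \<open>A two-element poset\<close>

abbreviation coe :: "nat \<Rightarrow> expr" where
  "coe i \<equiv> PI (TYPE_OF i) (\<lambda>A. PI (TYPE_OF i) (\<lambda>B. ID (TYPE_OF i) A B \<Rrightarrow> A \<Rrightarrow> B))"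

lemma coe: "provable (coe i)"
  apply (rule provableI[where e = "LM (TYPE_OF i) (\<lambda>A. LM (TYPE_OF i) (\<lambda>B.
     LM (ID (TYPE_OF i) A B) (\<lambda>e. PATHIND (\<lambda>Z. A \<Rrightarrow> Z) (LM A (\<lambda>a. a)) B e)))"])
  by (simp only: typecheck cong: weak_congs)

abbreviation coe_back :: "nat \<Rightarrow> expr" where
  "coe_back i \<equiv> PI (TYPE_OF i) (\<lambda>A. PI (TYPE_OF i) (\<lambda>B. ID (TYPE_OF i) A B \<Rrightarrow> B \<Rrightarrow> A))"

lemma coe_back: "provable (coe_back i)"
  apply (rule provableI[where e = "LM (TYPE_OF i) (\<lambda>A. LM (TYPE_OF i) (\<lambda>B.
     LM (ID (TYPE_OF i) A B) (\<lambda>e. PATHIND (\<lambda>Z. Z \<Rrightarrow> A) (LM A (\<lambda>a. a)) B e)))"])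
  by (simp only: typecheck cong: weak_congs)

abbreviation prop_back :: "nat \<Rightarrow> expr" where
  "prop_back i \<equiv> PI (TYPE_OF i) (\<lambda>A. PI (TYPE_OF i) (\<lambda>B.
     ID (TYPE_OF i) A B \<Rrightarrow> is_proposition B \<Rrightarrow> is_proposition A))"

lemma prop_back: "provable (prop_back i)"
  apply (rule provableI[where e = "LM (TYPE_OF i) (\<lambda>A. LM (TYPE_OF i) (\<lambda>B.
     LM (ID (TYPE_OF i) A B) (\<lambda>e. PATHIND (\<lambda>Z. is_proposition Z \<Rrightarrow> is_proposition A)
       (LM (is_proposition A) (\<lambda>h. h)) B e)))"])
  by (simp only: typecheck cong: weak_congs)

lemma unit_prop: "provable (is_proposition (ONE i))"
  apply (rule provableI[where e = "LM (ONE i) (\<lambda>a. LM (ONE i) (\<lambda>b.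
     UNITIND (\<lambda>z. ID (ONE i) z b)
       (UNITIND (\<lambda>z. ID (ONE i) (STAR i) z) (RFL (STAR i)) b) a))"])
  by (simp only: typecheck cong: weak_congs)

abbreviation arrow_prop :: "nat \<Rightarrow> expr" where
  "arrow_prop i \<equiv> PI (TYPE_OF i) (\<lambda>A. PI (TYPE_OF i) (\<lambda>B.
     is_proposition B \<Rrightarrow> is_proposition (A \<Rrightarrow> B)))"

lemma arrow_prop: "provable (arrow_prop i)"
  apply (rule provableI[where e = "LM (TYPE_OF i) (\<lambda>A. LM (TYPE_OF i) (\<lambda>B.
     LM (is_proposition B) (\<lambda>h. LM (A \<Rrightarrow> B) (\<lambda>f. LM (A \<Rrightarrow> B) (\<lambda>g.
       FUNEXT f g (LM A (\<lambda>a. h \<cdot> (f \<cdot> a) \<cdot> (g \<cdot> a))))))))"])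
  by (simp only: typecheck cong: weak_congs)

abbreviation prop_equiv :: "nat \<Rightarrow> nat \<Rightarrow> expr" where
  "prop_equiv i j \<equiv> PI (TYPE_OF i) (\<lambda>A. PI (TYPE_OF j) (\<lambda>B.
     is_proposition A \<Rrightarrow> is_proposition B \<Rrightarrow> (A \<Rrightarrow> B) \<Rrightarrow> (B \<Rrightarrow> A) \<Rrightarrow> EQUIV A B))"

lemma prop_equiv: "provable (prop_equiv i j)"
  apply (rule provableI[where e = "LM (TYPE_OF i) (\<lambda>A. LM (TYPE_OF j) (\<lambda>B.
     LM (is_proposition A) (\<lambda>hA. LM (is_proposition B) (\<lambda>hB. LM (A \<Rrightarrow> B) (\<lambda>f. LM (B \<Rrightarrow> A) (\<lambda>g.
       PAIR f (PAIR
         (PAIR g (LM B (\<lambda>b. hB \<cdot> (f \<cdot> (g \<cdot> b)) \<cdot> b)))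
         (PAIR g (LM A (\<lambda>a. hA \<cdot> (g \<cdot> (f \<cdot> a)) \<cdot> a))))))))))"])
  by (simp only: typecheck cong: weak_congs)

section \<open>The two-element type and its family of truth values\<close>

abbreviation TWO :: "nat \<Rightarrow> expr" where
  "TWO u \<equiv> ONE u \<oplus> ONE u"

abbreviation fam_0 :: "nat \<Rightarrow> nat \<Rightarrow> expr \<Rightarrow> expr" where
  "fam_0 u i T \<equiv> PI (ONE u) (\<lambda>j. ID (TYPE_OF i) (T \<cdot> INL j) (ZERO i))"

abbreviation fam_1 :: "nat \<Rightarrow> nat \<Rightarrow> expr \<Rightarrow> expr" where
  "fam_1 u i T \<equiv> PI (ONE u) (\<lambda>j. ID (TYPE_OF i) (T \<cdot> INR j) (ONE i))"

abbreviation two_fam :: "nat \<Rightarrow> nat \<Rightarrow> expr" where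
  "two_fam u i \<equiv> SG (TWO u \<Rrightarrow> TYPE_OF i) (\<lambda>T. fam_0 u i T \<otimes> fam_1 u i T)"

text \<open>A case distinction into a universe, whence the level \<open>Suc i\<close>. Only its two
  equations are exported; later terms transport along them.\<close>

lemma two_fam: "provable (two_fam u i)"
  apply (rule provable_mp[OF case_inl[of u u "Suc i"]], simp only: typecheck cong: weak_congs)
  apply (rule provable_mp[OF case_inr[of u u "Suc i"]], simp only: typecheck cong: weak_congs)
  apply (rule provableI[where e = "LM (case_inr u u (Suc i)) (\<lambda>cr. LM (case_inl u u (Suc i)) (\<lambda>cl.
     PAIR (LM (TWO u) (\<lambda>s. CASE (TYPE_OF i) (ZERO i) (ONE i) s)) (PAIR
       (cl \<cdot> ONE u \<cdot> ONE u \<cdot> TYPE_OF i \<cdot> ZERO i \<cdot> ONE i)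
       (cr \<cdot> ONE u \<cdot> ONE u \<cdot> TYPE_OF i \<cdot> ZERO i \<cdot> ONE i))))"])
  by (simp only: typecheck cong: weak_congs)

abbreviation two_prop :: "nat \<Rightarrow> nat \<Rightarrow> expr" where
  "two_prop u i \<equiv> PI (TWO u \<Rrightarrow> TYPE_OF i) (\<lambda>T. fam_0 u i T \<Rrightarrow> fam_1 u i T \<Rrightarrow>
     PI (TWO u) (\<lambda>b. is_proposition (T \<cdot> b)))"

lemma two_prop: "provable (two_prop u i)"
  apply (rule provable_mp[OF coe[of i]], simp only: typecheck cong: weak_congs)
  apply (rule provable_mp[OF prop_back[of i]], simp only: typecheck cong: weak_congs)
  apply (rule provable_mp[OF unit_prop[of i]], simp only: typecheck cong: weak_congs)
  apply (rule provableI[where e = "LM (is_proposition (ONE i)) (\<lambda>up. LM (prop_back i) (\<lambda>pb. LM (coe i) (\<lambda>co.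
     LM (TWO u \<Rrightarrow> TYPE_OF i) (\<lambda>T. LM (fam_0 u i T) (\<lambda>e0. LM (fam_1 u i T) (\<lambda>e1. LM (TWO u) (\<lambda>b.
     PLUSIND (\<lambda>b. is_proposition (T \<cdot> b))
       (\<lambda>j. LM (T \<cdot> INL j) (\<lambda>p. LM (T \<cdot> INL j) (\<lambda>q. EXFALSO (ID (T \<cdot> INL j) p q)
          (co \<cdot> (T \<cdot> INL j) \<cdot> ZERO i \<cdot> (e0 \<cdot> j) \<cdot> p))))
       (\<lambda>j. pb \<cdot> (T \<cdot> INR j) \<cdot> ONE i \<cdot> (e1 \<cdot> j) \<cdot> up) b)))))))"])
  by (simp only: typecheck cong: weak_congs)

abbreviation two_dec :: "nat \<Rightarrow> nat \<Rightarrow> expr" where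
  "two_dec u i \<equiv> PI (TWO u \<Rrightarrow> TYPE_OF i) (\<lambda>T. fam_0 u i T \<Rrightarrow> fam_1 u i T \<Rrightarrow>
     PI (TWO u) (\<lambda>b. T \<cdot> b \<oplus> NEG (T \<cdot> b)))"

lemma two_dec: "provable (two_dec u i)"
  apply (rule provable_mp[OF coe[of i]], simp only: typecheck cong: weak_congs)
  apply (rule provable_mp[OF coe_back[of i]], simp only: typecheck cong: weak_congs)
  apply (rule provableI[where e = "LM (coe_back i) (\<lambda>cb. LM (coe i) (\<lambda>co.
     LM (TWO u \<Rrightarrow> TYPE_OF i) (\<lambda>T. LM (fam_0 u i T) (\<lambda>e0. LM (fam_1 u i T) (\<lambda>e1. LM (TWO u) (\<lambda>b.
     PLUSIND (\<lambda>b. T \<cdot> b \<oplus> NEG (T \<cdot> b))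
       (\<lambda>j. INR (LM (T \<cdot> INL j) (\<lambda>p. EXFALSO (ZERO 0)
          (co \<cdot> (T \<cdot> INL j) \<cdot> ZERO i \<cdot> (e0 \<cdot> j) \<cdot> p))))
       (\<lambda>j. INL (cb \<cdot> (T \<cdot> INR j) \<cdot> ONE i \<cdot> (e1 \<cdot> j) \<cdot> STAR i)) b))))))"])
  by (simp only: typecheck cong: weak_congs)

abbreviation two_map :: "nat \<Rightarrow> nat \<Rightarrow> nat \<Rightarrow> expr" where
  "two_map u i j \<equiv> PI (TWO u \<Rrightarrow> TYPE_OF i) (\<lambda>T. PI (TWO u \<Rrightarrow> TYPE_OF j) (\<lambda>T'.
     fam_0 u i T \<Rrightarrow> fam_1 u j T' \<Rrightarrow> PI (TWO u) (\<lambda>b. T \<cdot> b \<Rrightarrow> T' \<cdot> b)))"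

text \<open>On the left summand the assumption transports into an empty type; on the right the
  conclusion is inhabited. The separate levels allow comparing both copies of the family in either
  direction.\<close>

lemma two_map: "provable (two_map u i j)"
  apply (rule provable_mp[OF coe[of i]], simp only: typecheck cong: weak_congs)
  apply (rule provable_mp[OF coe_back[of j]], simp only: typecheck cong: weak_congs)
  apply (rule provableI[where e = "LM (coe_back j) (\<lambda>cb. LM (coe i) (\<lambda>co.
     LM (TWO u \<Rrightarrow> TYPE_OF i) (\<lambda>T. LM (TWO u \<Rrightarrow> TYPE_OF j) (\<lambda>T'.
     LM (fam_0 u i T) (\<lambda>e0. LM (fam_1 u j T') (\<lambda>e1. LM (TWO u) (\<lambda>b.
     PLUSIND (\<lambda>b. T \<cdot> b \<Rrightarrow> T' \<cdot> b)
       (\<lambda>k. LM (T \<cdot> INL k) (\<lambda>p. EXFALSO (T' \<cdot> INL k)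
          (co \<cdot> (T \<cdot> INL k) \<cdot> ZERO i \<cdot> (e0 \<cdot> k) \<cdot> p)))
       (\<lambda>k. LM (T \<cdot> INR k) (\<lambda>_. cb \<cdot> (T' \<cdot> INR k) \<cdot> ONE j \<cdot> (e1 \<cdot> k) \<cdot> STAR j)) b)))))))"])
  by (simp only: typecheck cong: weak_congs)

abbreviation two_eq_1 :: "nat \<Rightarrow> nat \<Rightarrow> expr" where
  "two_eq_1 u i \<equiv> PI (TWO u \<Rrightarrow> TYPE_OF i) (\<lambda>T. fam_0 u i T \<Rrightarrow>
     PI (TWO u) (\<lambda>b. T \<cdot> b \<Rrightarrow> ID (TWO u) (INR (STAR u)) b))"

text \<open>Transport into the empty type excludes the left summand; on the right, unit induction
  reaches every element from \<open>STAR u\<close>.\<close>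

lemma two_eq_1: "provable (two_eq_1 u i)"
  apply (rule provable_mp[OF coe[of i]], simp only: typecheck cong: weak_congs)
  apply (rule provableI[where e = "LM (coe i) (\<lambda>co.
     LM (TWO u \<Rrightarrow> TYPE_OF i) (\<lambda>T. LM (fam_0 u i T) (\<lambda>e0. LM (TWO u) (\<lambda>b.
     PLUSIND (\<lambda>b. T \<cdot> b \<Rrightarrow> ID (TWO u) (INR (STAR u)) b)
       (\<lambda>k. LM (T \<cdot> INL k) (\<lambda>p. EXFALSO (ID (TWO u) (INR (STAR u)) (INL k))
          (co \<cdot> (T \<cdot> INL k) \<cdot> ZERO i \<cdot> (e0 \<cdot> k) \<cdot> p)))
       (\<lambda>k. LM (T \<cdot> INR k) (\<lambda>_. UNITIND (\<lambda>z. ID (TWO u) (INR (STAR u)) (INR z))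
          (RFL (INR (STAR u))) k)) b))))"])
  by (simp only: typecheck cong: weak_congs)

abbreviation two_eq_0 :: "nat \<Rightarrow> nat \<Rightarrow> expr" where
  "two_eq_0 u i \<equiv> PI (TWO u \<Rrightarrow> TYPE_OF i) (\<lambda>T. fam_1 u i T \<Rrightarrow>
     PI (TWO u) (\<lambda>b. NEG (T \<cdot> b) \<Rrightarrow> ID (TWO u) (INL (STAR u)) b))"

lemma two_eq_0: "provable (two_eq_0 u i)"
  apply (rule provable_mp[OF coe_back[of i]], simp only: typecheck cong: weak_congs)
  apply (rule provableI[where e = "LM (coe_back i) (\<lambda>cb.
     LM (TWO u \<Rrightarrow> TYPE_OF i) (\<lambda>T. LM (fam_1 u i T) (\<lambda>e1. LM (TWO u) (\<lambda>b.
     PLUSIND (\<lambda>b. NEG (T \<cdot> b) \<Rrightarrow> ID (TWO u) (INL (STAR u)) b)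
       (\<lambda>k. LM (NEG (T \<cdot> INL k)) (\<lambda>_. UNITIND (\<lambda>z. ID (TWO u) (INL (STAR u)) (INL z))
          (RFL (INL (STAR u))) k))
       (\<lambda>k. LM (NEG (T \<cdot> INR k)) (\<lambda>n. EXFALSO (ID (TWO u) (INL (STAR u)) (INR k))
          (n \<cdot> (cb \<cdot> (T \<cdot> INR k) \<cdot> ONE i \<cdot> (e1 \<cdot> k) \<cdot> STAR i)))) b))))"])
  by (simp only: typecheck cong: weak_congs)

text \<open>
  \<open>T\<close> is the subset consisting of the top element; the order will be \<open>T x \<Rightarrow> T y\<close>. The copy \<open>T'\<close> of
  \<open>T\<close> in the universe \<open>v\<close> serves to show that this order is locally small.
\<close>

abbreviation bool_structure :: "nat \<Rightarrow> nat \<Rightarrow> nat \<Rightarrow> expr" where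
  "bool_structure u t v \<equiv> SG (TYPE_OF u) (\<lambda>X. SG (X \<Rrightarrow> TYPE_OF t) (\<lambda>T. SG (X \<Rrightarrow> TYPE_OF v) (\<lambda>T'.
     PI X (\<lambda>x. is_proposition (T \<cdot> x)) \<otimes> PI X (\<lambda>x. is_proposition (T' \<cdot> x)) \<otimes>
     PI X (\<lambda>x. T \<cdot> x \<Rrightarrow> T' \<cdot> x) \<otimes> PI X (\<lambda>x. T' \<cdot> x \<Rrightarrow> T \<cdot> x) \<otimes>
     PI X (\<lambda>x. T \<cdot> x \<oplus> NEG (T \<cdot> x)) \<otimes>
     SG X (\<lambda>x0. SG X (\<lambda>x1. NEG (T \<cdot> x0) \<otimes> T \<cdot> x1 \<otimes>
       PI X (\<lambda>x. NEG (T \<cdot> x) \<Rrightarrow> ID X x0 x) \<otimes> PI X (\<lambda>x. T \<cdot> x \<Rrightarrow> ID X x1 x))))))"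

lemma bool_structure: "provable (bool_structure u t v)"
  apply (rule provable_mp[OF two_fam[of u t]], simp only: typecheck cong: weak_congs)
  apply (rule provable_mp[OF two_fam[of u v]], simp only: typecheck cong: weak_congs)
  apply (rule provable_mp[OF two_prop[of u t]], simp only: typecheck cong: weak_congs)
  apply (rule provable_mp[OF two_prop[of u v]], simp only: typecheck cong: weak_congs)
  apply (rule provable_mp[OF two_map[of u t v]], simp only: typecheck cong: weak_congs)
  apply (rule provable_mp[OF two_map[of u v t]], simp only: typecheck cong: weak_congs)
  apply (rule provable_mp[OF two_dec[of u t]], simp only: typecheck cong: weak_congs)
  apply (rule provable_mp[OF two_eq_0[of u t]], simp only: typecheck cong: weak_congs)
  apply (rule provable_mp[OF two_eq_1[of u t]], simp only: typecheck cong: weak_congs)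
  apply (rule provable_mp[OF coe[of t]], simp only: typecheck cong: weak_congs)
  apply (rule provable_mp[OF coe_back[of t]], simp only: typecheck cong: weak_congs)
  apply (rule provableI[where e = "LM (coe_back t) (\<lambda>cb. LM (coe t) (\<lambda>co.
     LM (two_eq_1 u t) (\<lambda>q1. LM (two_eq_0 u t) (\<lambda>q0. LM (two_dec u t) (\<lambda>td.
     LM (two_map u v t) (\<lambda>mb. LM (two_map u t v) (\<lambda>mf.
     LM (two_prop u v) (\<lambda>pv. LM (two_prop u t) (\<lambda>pt. LM (two_fam u v) (\<lambda>fv. LM (two_fam u t) (\<lambda>ft.
     SPLIT (bool_structure u t v) ft (\<lambda>T S. SPLIT (bool_structure u t v) S (\<lambda>e0 e1.
     SPLIT (bool_structure u t v) fv (\<lambda>T' S. SPLIT (bool_structure u t v) S (\<lambda>e0' e1'.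
       PAIR (TWO u) (PAIR T (PAIR T' (PAIR (pt \<cdot> T \<cdot> e0 \<cdot> e1) (PAIR (pv \<cdot> T' \<cdot> e0' \<cdot> e1')
         (PAIR (mf \<cdot> T \<cdot> T' \<cdot> e0 \<cdot> e1') (PAIR (mb \<cdot> T' \<cdot> T \<cdot> e0' \<cdot> e1)
         (PAIR (td \<cdot> T \<cdot> e0 \<cdot> e1) (PAIR (INL (STAR u)) (PAIR (INR (STAR u))
         (PAIR (LM (T \<cdot> INL (STAR u)) (\<lambda>p. EXFALSO (ZERO 0)
            (co \<cdot> (T \<cdot> INL (STAR u)) \<cdot> ZERO t \<cdot> (e0 \<cdot> STAR u) \<cdot> p)))
         (PAIR (cb \<cdot> (T \<cdot> INR (STAR u)) \<cdot> ONE t \<cdot> (e1 \<cdot> STAR u) \<cdot> STAR t)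
         (PAIR (q0 \<cdot> T \<cdot> e1) (q1 \<cdot> T \<cdot> e0))))))))))))))))))))))))))))"])
  by (simp only: typecheck cong: weak_congs)

section \<open>The order induced by a subset\<close>

abbreviation beta_rel :: "nat \<Rightarrow> nat \<Rightarrow> expr" where
  "beta_rel u i \<equiv> PI (TYPE_OF u) (\<lambda>X. PI (X \<Rrightarrow> TYPE_OF i) (\<lambda>T. PI X (\<lambda>x. PI X (\<lambda>y.
     ID (TYPE_OF i) (LM X (\<lambda>x. LM X (\<lambda>y. T \<cdot> x \<Rrightarrow> T \<cdot> y)) \<cdot> x \<cdot> y) (T \<cdot> x \<Rrightarrow> T \<cdot> y)))))"

lemma beta_rel: "provable (beta_rel u i)"
  unfolding provable_def
  by (rule exI, simp only: typecheck, (rule t_lam)+)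
    (rule beta_rel_conv[simplified typecheck])

abbreviation induced :: "nat \<Rightarrow> expr \<Rightarrow> expr \<Rightarrow> expr \<Rightarrow> expr" where
  "induced i X T R \<equiv> PI X (\<lambda>x. PI X (\<lambda>y. ID (TYPE_OF i) (R \<cdot> x \<cdot> y) (T \<cdot> x \<Rrightarrow> T \<cdot> y)))"

abbreviation induced_rel :: "nat \<Rightarrow> nat \<Rightarrow> expr" where
  "induced_rel u i \<equiv> PI (TYPE_OF u) (\<lambda>X. PI (X \<Rrightarrow> TYPE_OF i) (\<lambda>T. SG (rel_on i X) (induced i X T)))"

text \<open>Once the relation is packed with its equation, later terms can treat it as a
  variable.\<close>

lemma induced_rel: "provable (induced_rel u i)"
  apply (rule provable_mp[OF beta_rel[of u i]], simp only: typecheck cong: weak_congs)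
  apply (rule provableI[where e = "LM (beta_rel u i) (\<lambda>b. LM (TYPE_OF u) (\<lambda>X. LM (X \<Rrightarrow> TYPE_OF i) (\<lambda>T.
     PAIR (LM X (\<lambda>x. LM X (\<lambda>y. T \<cdot> x \<Rrightarrow> T \<cdot> y))) (b \<cdot> X \<cdot> T))))"])
  by (simp only: typecheck cong: weak_congs)

text \<open>The part of the poset available without excluded middle. Decidability of the order is
  there for \<open>wem_complete\<close>, the failure of \<open>y\<close> below \<open>x\<close> for
  \<open>em_positive\<close>.\<close>

abbreviation model :: "nat \<Rightarrow> nat \<Rightarrow> nat \<Rightarrow> expr" where
  "model u t v \<equiv> SG (TYPE_OF u) (\<lambda>X. SG (rel_on t X) (\<lambda>R. prop_valued X R \<otimes> reflexive X R \<otimes>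
     transitive X R \<otimes> antisymmetric X R \<otimes> decidable_rel X R \<otimes> locally_small v X R \<otimes>
     SG X (\<lambda>x. SG X (\<lambda>y. R \<cdot> x \<cdot> y \<otimes> NEG (R \<cdot> y \<cdot> x)))))"

abbreviation bool_model :: "nat \<Rightarrow> nat \<Rightarrow> nat \<Rightarrow> expr" where
  "bool_model u t v \<equiv> PI (TYPE_OF u) (\<lambda>X. PI (X \<Rrightarrow> TYPE_OF t) (\<lambda>T. PI (X \<Rrightarrow> TYPE_OF v) (\<lambda>T'.
     PI X (\<lambda>x. is_proposition (T \<cdot> x)) \<Rrightarrow> PI X (\<lambda>x. is_proposition (T' \<cdot> x)) \<Rrightarrow>
     PI X (\<lambda>x. T \<cdot> x \<Rrightarrow> T' \<cdot> x) \<Rrightarrow> PI X (\<lambda>x. T' \<cdot> x \<Rrightarrow> T \<cdot> x) \<Rrightarrow>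
     PI X (\<lambda>x. T \<cdot> x \<oplus> NEG (T \<cdot> x)) \<Rrightarrow> PI X (\<lambda>x0. PI X (\<lambda>x1. NEG (T \<cdot> x0) \<Rrightarrow> T \<cdot> x1 \<Rrightarrow>
       PI X (\<lambda>x. NEG (T \<cdot> x) \<Rrightarrow> ID X x0 x) \<Rrightarrow> PI X (\<lambda>x. T \<cdot> x \<Rrightarrow> ID X x1 x) \<Rrightarrow>
     PI (rel_on t X) (\<lambda>R. induced t X T R \<Rrightarrow> PI (rel_on v X) (\<lambda>S. induced v X T' S \<Rrightarrow> model u t v)))))))"

lemma bool_model: "provable (bool_model u t v)"
  apply (rule provable_mp[OF prop_back[of t]], simp only: typecheck cong: weak_congs)
  apply (rule provable_mp[OF prop_back[of v]], simp only: typecheck cong: weak_congs)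
  apply (rule provable_mp[OF coe[of t]], simp only: typecheck cong: weak_congs)
  apply (rule provable_mp[OF coe[of v]], simp only: typecheck cong: weak_congs)
  apply (rule provable_mp[OF coe_back[of t]], simp only: typecheck cong: weak_congs)
  apply (rule provable_mp[OF coe_back[of v]], simp only: typecheck cong: weak_congs)
  apply (rule provable_mp[OF arrow_prop[of t]], simp only: typecheck cong: weak_congs)
  apply (rule provable_mp[OF arrow_prop[of v]], simp only: typecheck cong: weak_congs)
  apply (rule provable_mp[OF prop_equiv[of t v]], simp only: typecheck cong: weak_congs)
  \<comment> \<open>\<open>inR\<close> and \<open>outR\<close> transport between the order and
    implication, \<open>inS\<close> and \<open>outS\<close> do so for its small copy. Antisymmetry
    decides \<open>T x\<close>: either both elements equal \<open>x1\<close> or both equal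
    \<open>x0\<close>. Local smallness comes from \<open>prop_equiv\<close>, the two relations
    implying each other through \<open>f\<close> and \<open>g\<close>.\<close>
  apply (rule provableI[where e = "LM (prop_equiv t v) (\<lambda>pe.
     LM (arrow_prop v) (\<lambda>apv. LM (arrow_prop t) (\<lambda>apt. LM (coe_back v) (\<lambda>cbv. LM (coe_back t) (\<lambda>cbt.
     LM (coe v) (\<lambda>cov. LM (coe t) (\<lambda>cot. LM (prop_back v) (\<lambda>pbv. LM (prop_back t) (\<lambda>pbt.
     LM (TYPE_OF u) (\<lambda>X. LM (X \<Rrightarrow> TYPE_OF t) (\<lambda>T. LM (X \<Rrightarrow> TYPE_OF v) (\<lambda>T'.
     LM (PI X (\<lambda>x. is_proposition (T \<cdot> x))) (\<lambda>tp. LM (PI X (\<lambda>x. is_proposition (T' \<cdot> x))) (\<lambda>tp'.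
     LM (PI X (\<lambda>x. T \<cdot> x \<Rrightarrow> T' \<cdot> x)) (\<lambda>f. LM (PI X (\<lambda>x. T' \<cdot> x \<Rrightarrow> T \<cdot> x)) (\<lambda>g.
     LM (PI X (\<lambda>x. T \<cdot> x \<oplus> NEG (T \<cdot> x))) (\<lambda>dec. LM X (\<lambda>x0. LM X (\<lambda>x1. LM (NEG (T \<cdot> x0)) (\<lambda>n0. LM (T \<cdot> x1) (\<lambda>t1.
     LM (PI X (\<lambda>x. NEG (T \<cdot> x) \<Rrightarrow> ID X x0 x)) (\<lambda>q0. LM (PI X (\<lambda>x. T \<cdot> x \<Rrightarrow> ID X x1 x)) (\<lambda>q1.
     LM (rel_on t X) (\<lambda>R. LM (induced t X T R) (\<lambda>eR. LM (rel_on v X) (\<lambda>S. LM (induced v X T' S) (\<lambda>eS.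
     let inR = (\<lambda>x y. cbt \<cdot> (R \<cdot> x \<cdot> y) \<cdot> (T \<cdot> x \<Rrightarrow> T \<cdot> y) \<cdot> (eR \<cdot> x \<cdot> y));
         outR = (\<lambda>x y. cot \<cdot> (R \<cdot> x \<cdot> y) \<cdot> (T \<cdot> x \<Rrightarrow> T \<cdot> y) \<cdot> (eR \<cdot> x \<cdot> y));
         inS = (\<lambda>x y. cbv \<cdot> (S \<cdot> x \<cdot> y) \<cdot> (T' \<cdot> x \<Rrightarrow> T' \<cdot> y) \<cdot> (eS \<cdot> x \<cdot> y));
         outS = (\<lambda>x y. cov \<cdot> (S \<cdot> x \<cdot> y) \<cdot> (T' \<cdot> x \<Rrightarrow> T' \<cdot> y) \<cdot> (eS \<cdot> x \<cdot> y));
         Rp = (\<lambda>x y. pbt \<cdot> (R \<cdot> x \<cdot> y) \<cdot> (T \<cdot> x \<Rrightarrow> T \<cdot> y) \<cdot> (eR \<cdot> x \<cdot> y) \<cdot>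
           (apt \<cdot> (T \<cdot> x) \<cdot> (T \<cdot> y) \<cdot> (tp \<cdot> y)));
         Sp = (\<lambda>x y. pbv \<cdot> (S \<cdot> x \<cdot> y) \<cdot> (T' \<cdot> x \<Rrightarrow> T' \<cdot> y) \<cdot> (eS \<cdot> x \<cdot> y) \<cdot>
           (apv \<cdot> (T' \<cdot> x) \<cdot> (T' \<cdot> y) \<cdot> (tp' \<cdot> y)))
     in PAIR X (PAIR R
       (PAIR (LM X (\<lambda>x. LM X (\<lambda>y. Rp x y)))
       (PAIR (LM X (\<lambda>x. inR x x \<cdot> LM (T \<cdot> x) (\<lambda>p. p)))
       (PAIR (LM X (\<lambda>x. LM X (\<lambda>y. LM X (\<lambda>z. LM (R \<cdot> x \<cdot> y) (\<lambda>r. LM (R \<cdot> y \<cdot> z) (\<lambda>s.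
          inR x z \<cdot> LM (T \<cdot> x) (\<lambda>p. outR y z \<cdot> s \<cdot> (outR x y \<cdot> r \<cdot> p))))))))
       (PAIR (LM X (\<lambda>x. LM X (\<lambda>y. LM (R \<cdot> x \<cdot> y) (\<lambda>r. LM (R \<cdot> y \<cdot> x) (\<lambda>s.
          PLUSIND (\<lambda>_. ID X x y)
            (\<lambda>p. PATHIND (\<lambda>z. ID X z y) (q1 \<cdot> y \<cdot> (outR x y \<cdot> r \<cdot> p)) x (q1 \<cdot> x \<cdot> p))
            (\<lambda>n. PATHIND (\<lambda>z. ID X z y) (q0 \<cdot> y \<cdot> LM (T \<cdot> y) (\<lambda>p. n \<cdot> (outR y x \<cdot> s \<cdot> p))) x (q0 \<cdot> x \<cdot> n))
            (dec \<cdot> x))))))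
       (PAIR (LM X (\<lambda>x. LM X (\<lambda>y. PLUSIND (\<lambda>_. R \<cdot> x \<cdot> y \<oplus> NEG (R \<cdot> x \<cdot> y))
          (\<lambda>p. INL (inR x y \<cdot> LM (T \<cdot> x) (\<lambda>_. p)))
          (\<lambda>n. PLUSIND (\<lambda>_. R \<cdot> x \<cdot> y \<oplus> NEG (R \<cdot> x \<cdot> y))
            (\<lambda>p. INR (LM (R \<cdot> x \<cdot> y) (\<lambda>r. n \<cdot> (outR x y \<cdot> r \<cdot> p))))
            (\<lambda>m. INL (inR x y \<cdot> LM (T \<cdot> x) (\<lambda>p. EXFALSO (T \<cdot> y) (m \<cdot> p)))) (dec \<cdot> x))
          (dec \<cdot> y))))
       (PAIR (PAIR S (LM X (\<lambda>x. LM X (\<lambda>y. pe \<cdot> (R \<cdot> x \<cdot> y) \<cdot> (S \<cdot> x \<cdot> y) \<cdot> Rp x y \<cdot> Sp x y \<cdot>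
          LM (R \<cdot> x \<cdot> y) (\<lambda>r. inS x y \<cdot> LM (T' \<cdot> x) (\<lambda>p. f \<cdot> y \<cdot> (outR x y \<cdot> r \<cdot> (g \<cdot> x \<cdot> p)))) \<cdot>
          LM (S \<cdot> x \<cdot> y) (\<lambda>r. inR x y \<cdot> LM (T \<cdot> x) (\<lambda>p. g \<cdot> y \<cdot> (outS x y \<cdot> r \<cdot> (f \<cdot> x \<cdot> p))))))))
       (PAIR x0 (PAIR x1 (PAIR (inR x0 x1 \<cdot> LM (T \<cdot> x0) (\<lambda>_. t1))
          (LM (R \<cdot> x1 \<cdot> x0) (\<lambda>r. n0 \<cdot> (outR x1 x0 \<cdot> r \<cdot> t1))))))))))))))))))))))))))))))))))))))))"])
  by (simp only: Let_def typecheck cong: weak_congs)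

text \<open>The two-element data and both induced relations are unpacked first, so that
  \<open>bool_model\<close> is applied to variables only.\<close>

lemma model: "provable (model u t v)"
  apply (rule provable_mp[OF bool_structure[of u t v]], simp only: typecheck cong: weak_congs)
  apply (rule provable_mp[OF bool_model[of u t v]], simp only: typecheck cong: weak_congs)
  apply (rule provable_mp[OF induced_rel[of u t]], simp only: typecheck cong: weak_congs)
  apply (rule provable_mp[OF induced_rel[of u v]], simp only: typecheck cong: weak_congs)
  apply (rule provableI[where e = "LM (induced_rel u v) (\<lambda>iv. LM (induced_rel u t) (\<lambda>it.
     LM (bool_model u t v) (\<lambda>bm. LM (bool_structure u t v) (\<lambda>B. let C = model u t v in
     SPLIT C B (\<lambda>X B. SPLIT C B (\<lambda>T B. SPLIT C B (\<lambda>T' B. SPLIT C B (\<lambda>tp B. SPLIT C B (\<lambda>tp' B.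
     SPLIT C B (\<lambda>f B. SPLIT C B (\<lambda>g B. SPLIT C B (\<lambda>dec B. SPLIT C B (\<lambda>x0 B. SPLIT C B (\<lambda>x1 B.
     SPLIT C B (\<lambda>n0 B. SPLIT C B (\<lambda>t1 B. SPLIT C B (\<lambda>q0 q1.
     SPLIT C (it \<cdot> X \<cdot> T) (\<lambda>R eR. SPLIT C (iv \<cdot> X \<cdot> T') (\<lambda>S eS.
       bm \<cdot> X \<cdot> T \<cdot> T' \<cdot> tp \<cdot> tp' \<cdot> f \<cdot> g \<cdot> dec \<cdot> x0 \<cdot> x1 \<cdot> n0 \<cdot> t1 \<cdot> q0 \<cdot> q1 \<cdot> R \<cdot> eR \<cdot> S \<cdot> eS)))))))))))))))))))"])
  by (simp only: Let_def typecheck cong: weak_congs)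

section \<open>The posets obtained from (weak) excluded middle, and the equivalences\<close>

lemma wem_imp_exists_nontrivial:
  "provable (weak_excluded_middle v \<Rrightarrow> exists_poset u t v (\<lambda>X R tr c. nontrivial X R))"
  apply (rule provable_mp[OF model[of u t v]], simp only: typecheck cong: weak_congs)
  \<comment> \<open>Variables are instantiated in order of occurrence, and \<open>v\<close> occurs
    first in the unfolded statement.\<close>
  apply (rule provable_mp[OF wem_complete[of v u t]], simp only: typecheck cong: weak_congs)
  apply (rule provable_mp[OF rel_dec_eq[of u t]], simp only: typecheck cong: weak_congs)
  \<comment> \<open>An equation of \<open>x\<close> and \<open>y\<close> would transport reflexivity
    at \<open>x\<close> to \<open>y\<close> below \<open>x\<close>, which \<open>n\<close>
    refutes.\<close>
  apply (rule provableI[where e = "LM (rel_dec_eq u t) (\<lambda>rd. LM (wem_complete u t v) (\<lambda>wc.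
     LM (model u t v) (\<lambda>M. LM (weak_excluded_middle v) (\<lambda>wem.
     let C = exists_poset u t v (\<lambda>X R tr c. nontrivial X R) in
     SPLIT C M (\<lambda>X M. SPLIT C M (\<lambda>R M. SPLIT C M (\<lambda>pv M. SPLIT C M (\<lambda>re M. SPLIT C M (\<lambda>tr M.
     SPLIT C M (\<lambda>an M. SPLIT C M (\<lambda>dec M. SPLIT C M (\<lambda>ls M. SPLIT C M (\<lambda>x M. SPLIT C M (\<lambda>y M.
     SPLIT C M (\<lambda>l n. TRIN (PAIR X (PAIR R (PAIR pv (PAIR re (PAIR tr (PAIR an
       (PAIR (wc \<cdot> wem \<cdot> X \<cdot> R \<cdot> re \<cdot> dec) (PAIR ls (PAIR (rd \<cdot> X \<cdot> R \<cdot> re \<cdot> an \<cdot> dec)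
       (TRIN (PAIR x (TRIN (PAIR y (PAIR l
         (LM (ID X x y) (\<lambda>e. n \<cdot> PATHIND (\<lambda>z. R \<cdot> z \<cdot> x) (re \<cdot> x) y e)))))))))))))))))))))))))))))))"])
  by (simp only: Let_def typecheck cong: weak_congs)

text \<open>Positivity refers to the completeness witness, so the same term \<open>c\<close> has to
  enter both the poset and \<open>em_positive\<close>.\<close>

lemma em_imp_exists_positive:
  "provable (excluded_middle v \<Rrightarrow> exists_poset u t v (\<lambda>X R tr c. positive v X R tr c))"
  apply (rule provable_mp[OF model[of u t v]], simp only: typecheck cong: weak_congs)
  apply (rule provable_mp[OF wem_complete[of v u t]], simp only: typecheck cong: weak_congs)
  apply (rule provable_mp[OF rel_dec_eq[of u t]], simp only: typecheck cong: weak_congs)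
  apply (rule provable_mp[OF em_wem[of v]], simp only: typecheck cong: weak_congs)
  apply (rule provable_mp[OF em_positive[of v u t]], simp only: typecheck cong: weak_congs)
  apply (rule provableI[where e = "LM (em_positive u t v) (\<lambda>ep. LM (em_wem v) (\<lambda>ew.
     LM (rel_dec_eq u t) (\<lambda>rd. LM (wem_complete u t v) (\<lambda>wc.
     LM (model u t v) (\<lambda>M. LM (excluded_middle v) (\<lambda>em.
     let C = exists_poset u t v (\<lambda>X R tr c. positive v X R tr c) in
     SPLIT C M (\<lambda>X M. SPLIT C M (\<lambda>R M. SPLIT C M (\<lambda>pv M. SPLIT C M (\<lambda>re M. SPLIT C M (\<lambda>tr M.
     SPLIT C M (\<lambda>an M. SPLIT C M (\<lambda>dec M. SPLIT C M (\<lambda>ls M. SPLIT C M (\<lambda>x M. SPLIT C M (\<lambda>y M.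
     SPLIT C M (\<lambda>l n. let c = wc \<cdot> (ew \<cdot> em) \<cdot> X \<cdot> R \<cdot> re \<cdot> dec in
       TRIN (PAIR X (PAIR R (PAIR pv (PAIR re (PAIR tr (PAIR an
       (PAIR c (PAIR ls (PAIR (rd \<cdot> X \<cdot> R \<cdot> re \<cdot> an \<cdot> dec)
         (ep \<cdot> em \<cdot> X \<cdot> R \<cdot> re \<cdot> tr \<cdot> c \<cdot> x \<cdot> y \<cdot> l \<cdot> n)))))))))))))))))))))))))))"])
  by (simp only: Let_def typecheck cong: weak_congs)

text \<open>\<open>t_pair\<close> asks that the type of the second component be well formed, in a
  context that must be \<open>ok_ctx\<close>; running \<open>infer\<close> provides both, at
  whatever levels result. The equation on \<open>inst\<close> expresses that the converse
  implication is closed.\<close>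

lemma provable_IFF:
  assumes "provable (A \<Rrightarrow> B)" "provable (B \<Rrightarrow> A)"
    and "\<And>e. inst ((B \<Rrightarrow> A) (Suc 0)) e = (B \<Rrightarrow> A) 0"
    and "dest_univ (infer 100 [] ((A \<Rrightarrow> B) 0)) \<noteq> None"
    and "dest_univ (infer 100 [(A \<Rrightarrow> B) 0] ((B \<Rrightarrow> A) (Suc 0))) \<noteq> None"
  shows "provable (IFF A B)"
proof -
  obtain f g where f: "[] \<turnstile> f \<^bold>: (A \<Rrightarrow> B) 0" and g: "[] \<turnstile> g \<^bold>: (B \<Rrightarrow> A) 0"
    using assms(1,2) unfolding provable_def by blast
  from assms(4,5) obtain i j where "infer 100 [] ((A \<Rrightarrow> B) 0) = Some (Univ i)"
    and *: "infer 100 [(A \<Rrightarrow> B) 0] ((B \<Rrightarrow> A) (Suc 0)) = Some (Univ j)"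
    by (auto simp: dest_eq_Some)
  then have "[] \<turnstile> (A \<Rrightarrow> B) 0 \<^bold>: Univ i"
    by (simp add: infer_sound)
  then have "[(A \<Rrightarrow> B) 0] \<turnstile> (B \<Rrightarrow> A) (Suc 0) \<^bold>: Univ j"
    using infer_sound[OF *] by auto
  from t_pair[OF this f] g assms(3) have "[] \<turnstile> Pr f g \<^bold>: IFF A B 0"
    by (simp add: IFF_def PROD_def SG_def)
  then show ?thesis unfolding provable_def by blast
qed

theorem theorem4p31:
  fixes u t v :: nat
  shows "provable (IFF (exists_poset u t v (\<lambda>X R tr c. nontrivial X R)) (weak_excluded_middle v))
       \<and> provable (IFF (exists_poset u t v (\<lambda>X R tr c. positive v X R tr c)) (excluded_middle v))"
proof
  show "provable (IFF (exists_poset u t v (\<lambda>X R tr c. nontrivial X R)) (weak_excluded_middle v))"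
    by (rule provable_IFF[OF exists_nontrivial_imp_wem wem_imp_exists_nontrivial];
        simp only: typecheck option.distinct not_False_eq_True cong: weak_congs)
  show "provable (IFF (exists_poset u t v (\<lambda>X R tr c. positive v X R tr c)) (excluded_middle v))"
    by (rule provable_IFF[OF exists_positive_imp_em em_imp_exists_positive];
        simp only: typecheck option.distinct not_False_eq_True cong: weak_congs)
qed

end
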